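(* Let $n\geq 0$ be an integer and let $s\in\mathbb{C}$ be such that $s$ is not a nonzero integer. Then $$\begin{aligned}(2^{s}-1)\,\zeta(s)=&-\pi^{s-1}\sin(\pi s/2)\sum_{j=0}^{\lfloor (n-1)/2\rfloor}\frac{\Gamma(2j+1-s)\,\mathcal{E}(2j)}{\Gamma(2j+1)}\\&+\frac{\pi^{s-n}e^{i\pi n/2}}{2\,\Gamma(s-n)\cos(\pi s/2)}\sum_{k=0}^{\infty}\frac{E_{1+n-s}\bigl(-i\pi(k+\frac12)\bigr)+(-1)^n E_{1+n-s}\bigl(i\pi(k+\frac12)\bigr)}{(k+\frac12)^n}.\end{aligned}$$
   Context: $\zeta$ is the Riemann zeta function; $1/\Gamma$ is regarded as an entire function (zero at the poles of $\Gamma$). $\mathcal{E}(n)$ denotes the $n$-th Euler number, $1/\cosh x=\sum_{n\ge0}\mathcal{E}(n)x^n/n!$ (so $\mathcal{E}(0)=1$, $\mathcal{E}(2)=-1$, $\mathcal{E}(4)=5$). A sum whose lower limit exceeds its upper limit is zero. $E_s(z)$ is the (generalized) exponential integral: for $z=\pm i\kappa$ with $\kappa>0$, $E_s(z)=\int_1^\infty v^{-s}e^{-zv}\,dv$ (improper integral, convergent for $\Re(s)>0$), extended to all $s\in\mathbb{C}$ by analytic continuation in $s$; equivalently $E_s(z)=z^{s-1}\Gamma(1-s,z)$ with principal branches. The infinite series is understood as a (possibly conditionally) convergent series. *)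

theory Defs
  imports "HOL-Complex_Analysis.Complex_Analysis"
begin

text \<open>
  The value at \<open>s\<close> of the analytic continuation of the Dirichlet series of \<open>n\<close> powr \<open>- s\<close>
  to the plane without \<open>1\<close>. Nothing is specified at the pole \<open>s = 1\<close>.
\<close>
definition riemann_zeta :: "complex \<Rightarrow> complex" where
  "riemann_zeta s = (THE w. \<exists>f. f holomorphic_on (- {1}) \<and>
     (\<forall>t. Re t > 1 \<longrightarrow> (\<lambda>n. of_nat (Suc n) powr (- t)) sums f t) \<and> w = f s)"

lemma riemann_zeta_eqI:
  assumes f: "f holomorphic_on (- {1})"
    and sums: "\<And>t. Re t > 1 \<Longrightarrow> (\<lambda>n. of_nat (Suc n) powr (- t)) sums f t"
    and s: "s \<noteq> 1"
  shows "riemann_zeta s = f s"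
  unfolding riemann_zeta_def
proof (rule the_equality)
  show "\<exists>g. g holomorphic_on (- {1}) \<and>
     (\<forall>t. Re t > 1 \<longrightarrow> (\<lambda>n. of_nat (Suc n) powr (- t)) sums g t) \<and> f s = g s"
    using f sums by blast
next
  fix w
  assume "\<exists>g. g holomorphic_on (- {1}) \<and>
     (\<forall>t. Re t > 1 \<longrightarrow> (\<lambda>n. of_nat (Suc n) powr (- t)) sums g t) \<and> w = g s"
  then obtain g where g: "g holomorphic_on (- {1})"
    "\<And>t. Re t > 1 \<Longrightarrow> (\<lambda>n. of_nat (Suc n) powr (- t)) sums g t" and w: "w = g s"
    by blast
  have eq: "g t = f t" if "Re t > 1" for t
    using g(2)[OF that] sums[OF that] by (rule sums_unique2)
  have "g s = f s"
  proof (rule analytic_continuation_open[where f = g and g = f and s = "{t. Re t > 1}" and s' = "- {1}"])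
    show "open {t. Re t > 1}" by (rule open_halfspace_Re_gt)
    show "{t. Re t > 1} \<noteq> {}" by (auto intro!: exI[of _ 2])
    show "connected (- {1::complex})"
      by (intro connected_punctured_universe) auto
    show "{t. Re t > 1} \<subseteq> - {1}" by auto
  qed (use f g(1) eq s in auto)
  then show "w = f s" using w by simp
qed

text \<open>
  The generalized exponential integral \<open>E\<^sub>s(z)\<close> as the analytic continuation in \<open>s\<close> of the
  improper integral over the half-line from \<open>1\<close>. Meant for \<open>Re z \<ge> 0\<close> and \<open>z \<noteq> 0\<close>, where the
  integral converges for \<open>Re s > 0\<close>; on the imaginary axis it may converge only conditionally,
  hence the explicit limit.
\<close>
definition exp_integral :: "complex \<Rightarrow> complex \<Rightarrow> complex" where
  "exp_integral s z = (THE w. \<exists>F. F holomorphic_on UNIV \<and>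
     (\<forall>t. Re t > 0 \<longrightarrow>
        ((\<lambda>b. integral {1..b} (\<lambda>v::real. of_real v powr (- t) * exp (- z * of_real v)))
          \<longlongrightarrow> F t) at_top) \<and> w = F s)"

lemma exp_integral_eqI:
  assumes F: "F holomorphic_on UNIV"
    and lim: "\<And>t. Re t > 0 \<Longrightarrow>
        ((\<lambda>b. integral {1..b} (\<lambda>v::real. of_real v powr (- t) * exp (- z * of_real v)))
          \<longlongrightarrow> F t) at_top"
  shows "exp_integral s z = F s"
  unfolding exp_integral_def
proof (rule the_equality)
  show "\<exists>G. G holomorphic_on UNIV \<and>
     (\<forall>t. Re t > 0 \<longrightarrow>
        ((\<lambda>b. integral {1..b} (\<lambda>v::real. of_real v powr (- t) * exp (- z * of_real v)))
          \<longlongrightarrow> G t) at_top) \<and> F s = G s"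
    using F lim by blast
next
  fix w
  assume "\<exists>G. G holomorphic_on UNIV \<and>
     (\<forall>t. Re t > 0 \<longrightarrow>
        ((\<lambda>b. integral {1..b} (\<lambda>v::real. of_real v powr (- t) * exp (- z * of_real v)))
          \<longlongrightarrow> G t) at_top) \<and> w = G s"
  then obtain G where G: "G holomorphic_on UNIV"
    "\<And>t. Re t > 0 \<Longrightarrow>
        ((\<lambda>b. integral {1..b} (\<lambda>v::real. of_real v powr (- t) * exp (- z * of_real v)))
          \<longlongrightarrow> G t) at_top" and w: "w = G s"
    by blast
  have eq: "G t = F t" if "Re t > 0" for t
    using trivial_limit_at_top_linorder G(2)[OF that] lim[OF that] by (rule tendsto_unique)
  have "G s = F s"
  proof (rule analytic_continuation_open[where f = G and g = F and s = "{t. Re t > 0}" and s' = UNIV])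
    show "open {t. Re t > 0}" by (rule open_halfspace_Re_gt)
    show "{t. Re t > 0} \<noteq> {}" by (auto intro!: exI[of _ 1])
  qed (use F G(1) eq in auto)
  then show "w = F s" using w by simp
qed

text \<open>Exponential generating function \<open>1 / cosh x\<close>, where \<open>cosh x = (exp x + exp (- x)) / 2\<close>.\<close>
definition euler_number :: "nat \<Rightarrow> real" where
  "euler_number n =
     fact n * fps_nth (inverse (fps_const (1 / 2) * (fps_exp 1 + fps_exp (- 1)))) n"

end

theory Submission
  imports Defs
begin

text \<open>
  The left-hand side is the Hurwitz series \<open>\<Sum>k. (k + 1/2) powr - s\<close> in disguise. Put
  \<open>\<kappa> = \<pi> (k + 1/2)\<close>, \<open>z = \<plusminus> \<i> \<kappa>\<close> and \<open>p = 1 + n - s\<close>. The exponential integral is the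
  complete Gamma integral minus its part over the unit interval,
  \<open>E\<^sub>p(z) = z powr (p - 1) * \<Gamma>(1 - p) - \<integral> v powr - p * exp (- z v)\<close> over \<open>0 < v \<le> 1\<close>
  (\<open>gamma_integral_rotated\<close>, by Cauchy's theorem, since \<open>z\<close> lies on the imaginary axis). The
  two complete Gamma integrals belonging to \<open>z\<close> and \<open>- z\<close> combine to a multiple of
  \<open>2 cos (\<pi> s / 2) (k + 1/2) powr - s\<close>, so that summed over \<open>k\<close> they give the left-hand
  side. In the remaining parts the sum over \<open>k\<close> may be taken inside the integral, where it is a
  Fourier series whose sum on the unit interval is a polynomial, and what is left is an
  elementary Beta integral.

  This computation is carried out only for \<open>n = 2\<close> and \<open>2 < Re s < 3\<close>, where the Fourier
  series \<open>\<Sum>k. cos (\<kappa> v) / (k + 1/2)\<^sup>2 = \<pi>\<^sup>2 (1 - v) / 2\<close> converges absolutely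
  (\<open>zeta_expansion_two_strip\<close>). After multiplication by \<open>2 cos (\<pi> s / 2)\<close> both sides are
  holomorphic away from \<open>s = 1\<close>, so the case \<open>n = 2\<close> follows for all \<open>s \<noteq> 1\<close>
  (\<open>zeta_expansion_two\<close>). Holomorphy of the series rests on bounds for \<open>E\<^sub>p(z)\<close> that are
  uniform in \<open>|z| \<ge> 1\<close>, \<open>Re z \<ge> 0\<close> and locally uniform in \<open>p\<close> (\<open>exp_integral_series\<close>).

  All other \<open>n\<close> are reached from \<open>n = 2\<close> by the recurrence
  \<open>p E\<^bsub>p+1\<^esub>(z) = exp (- z) - z E\<^sub>p(z)\<close>, used upwards and downwards. Its boundary terms
  \<open>exp (- z)\<close> cancel for odd \<open>n\<close>; for \<open>n = 2 m\<close> they sum to a multiple of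
  \<open>\<Sum>k. (-1)^k / (k + 1/2)^(2 m + 1)\<close>, which is a rational multiple of
  \<open>\<pi>^(2 m + 1)\<close> governed by the Euler number of index \<open>2 m\<close>
  (\<open>alternating_odd_power_sum\<close>), and by the reflection formula this is exactly the summand
  by which the finite sum grows (\<open>zeta_expansion_Suc\<close>).

  The zeta function itself needs a continuation to the punctured plane. It is obtained from the
  second-order Euler-Maclaurin formula, whose remainder becomes a series of exponential
  integrals at \<open>\<plusminus> 2 \<pi> \<i> k\<close> once the periodic Bernoulli polynomial is expanded into its
  Fourier series; that series is again entire by \<open>exp_integral_series\<close>.
\<close>


section \<open>Interchanging sums, limits and integrals\<close>

text \<open>
  Dominated convergence for a series whose terms are bounded by a summable sequence times one
  fixed integrable function. Every interchange of a Fourier series with an integral below has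
  this shape.
\<close>
lemma sums_has_integral_dominated:
  fixes g :: "nat \<Rightarrow> 'a::euclidean_space \<Rightarrow> 'b::euclidean_space"
  assumes int: "\<And>k. (g k has_integral I k) S"
    and h: "h integrable_on S" "\<And>v. v \<in> S \<Longrightarrow> h v \<ge> 0"
    and M: "summable M" "\<And>k. M k \<ge> 0"
    and le: "\<And>k v. v \<in> S \<Longrightarrow> norm (g k v) \<le> M k * h v"
    and sums: "\<And>v. v \<in> S \<Longrightarrow> (\<lambda>k. g k v) sums G v"
  shows "I sums integral S G" and "G integrable_on S"
proof -
  have int': "((\<lambda>v. \<Sum>k<n. g k v) has_integral (\<Sum>k<n. I k)) S" for n
    by (intro has_integral_sum int) auto
  have bound: "norm (\<Sum>k<n. g k v) \<le> suminf M * h v" if v: "v \<in> S" for n v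
  proof -
    have "norm (\<Sum>k<n. g k v) \<le> (\<Sum>k<n. M k * h v)"
      using le[OF v] by (intro sum_norm_le) auto
    also have "\<dots> = (\<Sum>k<n. M k) * h v" by (simp add: sum_distrib_right)
    also have "\<dots> \<le> suminf M * h v"
      using M h(2)[OF v] by (intro mult_right_mono sum_le_suminf) auto
    finally show ?thesis .
  qed
  note dom = dominated_convergence[where f = "\<lambda>n v. \<Sum>k<n. g k v" and h = "\<lambda>v. suminf M * h v" and g = G and S = S]
  have "(\<lambda>v. suminf M * h v) integrable_on S" using h(1) by (rule integrable_on_mult_right)
  note dom' = dom[OF _ this bound]
  show "G integrable_on S"
    by (rule dom') (use int' sums in \<open>auto simp: sums_def\<close>)
  have "(\<lambda>n. integral S (\<lambda>v. \<Sum>k<n. g k v)) \<longlonglongrightarrow> integral S G"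
    by (rule dom') (use int' sums in \<open>auto simp: sums_def\<close>)
  then show "I sums integral S G"
    unfolding integral_unique[OF int'] sums_def .
qed

text \<open>
  Recovers an absolutely convergent improper integral from the integrals over any sequence of
  sets that eventually captures each point.
\<close>
lemma integral_exhausting_limit:
  fixes G :: "'a::euclidean_space \<Rightarrow> 'b::euclidean_space"
  assumes G: "G absolutely_integrable_on S"
    and T: "\<And>n. T n \<subseteq> S" "\<And>n. G integrable_on T n"
    and ev: "\<And>v. v \<in> S \<Longrightarrow> \<forall>\<^sub>F n in sequentially. v \<in> T n"
  shows "(\<lambda>n. integral (T n) G) \<longlonglongrightarrow> integral S G"
proof -
  have "(\<lambda>n. integral S (\<lambda>v. if v \<in> T n then G v else 0)) \<longlonglongrightarrow> integral S G"
  proof (rule dominated_convergence(2))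
    show "(\<lambda>v. if v \<in> T n then G v else 0) integrable_on S" for n
      using T by (simp add: integrable_restrict_Int Int_absorb2)
    show "(\<lambda>v. norm (G v)) integrable_on S" using G by (simp add: absolutely_integrable_on_def)
    show "norm (if v \<in> T n then G v else 0) \<le> norm (G v)" for n v by simp
    show "(\<lambda>n. if v \<in> T n then G v else 0) \<longlonglongrightarrow> G v" if "v \<in> S" for v
      using ev[OF that] by (rule tendsto_eventually[OF eventually_mono]) simp
  qed
  then show ?thesis
    using T(1) by (simp add: integral_restrict_Int Int_absorb2)
qed


section \<open>Two Fourier series\<close>

lemma dirichlet_kernel_cos:
  fixes x :: real
  shows "sin (pi * x) * (1 + 2 * (\<Sum>k<N. cos (2 * pi * real (Suc k) * x))) = sin ((2 * real N + 1) * pi * x)"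
proof (induction N)
  case 0
  then show ?case by (simp add: mult_ac)
next
  case (Suc N)
  have "2 * (sin (pi * x) * cos (2 * pi * real (Suc N) * x))
      = sin (pi * x + 2 * pi * real (Suc N) * x) + sin (pi * x - 2 * pi * real (Suc N) * x)"
    by (simp add: sin_times_cos)
  also have "\<dots> = sin ((2 * real (Suc N) + 1) * pi * x) - sin ((2 * real N + 1) * pi * x)"
  proof -
    have "pi * x + 2 * pi * real (Suc N) * x = (2 * real (Suc N) + 1) * pi * x"
      by (simp add: algebra_simps)
    moreover have "pi * x - 2 * pi * real (Suc N) * x = - ((2 * real N + 1) * pi * x)"
      by (simp add: algebra_simps)
    ultimately show ?thesis by (simp only: sin_minus diff_conv_add_uminus)
  qed
  finally show ?case
    using Suc.IH by (simp only: sum.lessThan_Suc distrib_left)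
qed

text \<open>
  The derivative of the partial sum is a Dirichlet kernel, which oscillates but is not small.
  Adding the correction \<open>cos (M \<pi> x) / (M sin (\<pi> x))\<close>, with \<open>M = 2 N + 1\<close>, amounts to
  one integration by parts: the derivative of the corrected difference is of order \<open>1 / M\<close>
  away from the singularity at \<open>0\<close>, and the corrected difference vanishes at \<open>1 / 2\<close>.
\<close>
lemma sawtooth_partial_sum_bound:
  fixes d x :: real
  assumes d: "0 < d" "d \<le> x" "x \<le> 1 / 2"
  shows "\<bar>(\<Sum>k<N. sin (2 * pi * real (Suc k) * x) / real (Suc k)) - pi * (1 / 2 - x)\<bar>
           \<le> (pi / (sin (pi * d))\<^sup>2 + 1 / sin (pi * d)) / (2 * real N + 1)"
proof -
  define M where "M = 2 * real N + 1"
  have M: "M \<ge> 1" by (simp add: M_def)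
  define g where "g = (\<lambda>x. cos (M * pi * x) / (M * sin (pi * x)))"
  define S where "S = (\<lambda>x. \<Sum>k<N. sin (2 * pi * real (Suc k) * x) / real (Suc k))"
  define h where "h = (\<lambda>x. S x - pi * (1 / 2 - x) + g x)"
  have sd: "0 < sin (pi * d)"
    using d by (intro sin_gt_zero) auto
  have sin_ge: "sin (pi * d) \<le> sin (pi * y)" if "d \<le> y" "y \<le> 1 / 2" for y
    using that d by (intro sin_monotone_2pi_le) (auto intro: order_trans[of _ 0])
  have deriv: "(h has_field_derivative (- pi * cos (M * pi * y) * cos (pi * y) / (M * (sin (pi * y))\<^sup>2))) (at y)"
    if y: "d \<le> y" "y \<le> 1 / 2" for y
  proof -
    have sy: "sin (pi * y) > 0" using sin_ge[OF y] sd by linarith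
    have dS: "(S has_field_derivative (\<Sum>k<N. 2 * pi * cos (2 * pi * real (Suc k) * y))) (at y)"
      unfolding S_def
      by (rule DERIV_sum) (auto intro!: derivative_eq_intros simp del: of_nat_Suc simp: field_simps)
    have dg: "(g has_field_derivative (- pi * sin (M * pi * y) / sin (pi * y)
         - pi * cos (M * pi * y) * cos (pi * y) / (M * (sin (pi * y))\<^sup>2))) (at y)"
      unfolding g_def using sy M
      by (auto intro!: derivative_eq_intros simp: field_simps power2_eq_square)
    have "(\<Sum>k<N. 2 * pi * cos (2 * pi * real (Suc k) * y)) + pi
        = pi * (1 + 2 * (\<Sum>k<N. cos (2 * pi * real (Suc k) * y)))"
      by (simp add: sum_distrib_left algebra_simps)
    also have "1 + 2 * (\<Sum>k<N. cos (2 * pi * real (Suc k) * y)) = sin (M * pi * y) / sin (pi * y)"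
      unfolding M_def dirichlet_kernel_cos[symmetric] using sy by simp
    also have "pi * (sin (M * pi * y) / sin (pi * y)) = pi * sin (M * pi * y) / sin (pi * y)" by simp
    finally have *: "(\<Sum>k<N. 2 * pi * cos (2 * pi * real (Suc k) * y)) + pi
        = pi * sin (M * pi * y) / sin (pi * y)" .
    have "(h has_field_derivative ((\<Sum>k<N. 2 * pi * cos (2 * pi * real (Suc k) * y)) + pi
        + (- pi * sin (M * pi * y) / sin (pi * y)
         - pi * cos (M * pi * y) * cos (pi * y) / (M * (sin (pi * y))\<^sup>2)))) (at y)"
      unfolding h_def by (rule derivative_eq_intros dS dg refl)+ simp
    then show ?thesis unfolding * by simp
  qed
  have "norm (h x - h (1 / 2)) \<le> pi / (M * (sin (pi * d))\<^sup>2) * norm (x - 1 / 2)"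
  proof (rule field_differentiable_bound)
    show "convex {d..1/2}" by simp
    fix y assume y: "y \<in> {d..1/2}"
    show "(h has_field_derivative (- pi * cos (M * pi * y) * cos (pi * y) / (M * (sin (pi * y))\<^sup>2))) (at y within {d..1/2})"
      using deriv y by (auto intro: has_field_derivative_at_within)
    have "norm (- pi * cos (M * pi * y) * cos (pi * y) / (M * (sin (pi * y))\<^sup>2))
        = pi * (\<bar>cos (M * pi * y)\<bar> * \<bar>cos (pi * y)\<bar>) / (M * (sin (pi * y))\<^sup>2)"
      using M by (simp add: abs_mult)
    also have "\<dots> \<le> pi * (1 * 1) / (M * (sin (pi * d))\<^sup>2)"
      using sin_ge[of y] y sd M
      by (intro frac_le mult_left_mono mult_mono power_mono mult_pos_pos) auto
    finally show "norm (- pi * cos (M * pi * y) * cos (pi * y) / (M * (sin (pi * y))\<^sup>2)) \<le> pi / (M * (sin (pi * d))\<^sup>2)"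
      by simp
  qed (use d in auto)
  also have "\<dots> \<le> pi / (M * (sin (pi * d))\<^sup>2) * 1"
    using d M by (intro mult_left_mono) auto
  also have "h (1 / 2) = 0"
  proof -
    have "sin (2 * pi * real (Suc k) * (1 / 2)) = 0" for k
      by (simp add: sin_zero_iff_int2 del: of_nat_Suc)
    then have "S (1 / 2) = 0"
      by (simp add: S_def del: of_nat_Suc)
    moreover have "cos (M * pi * (1 / 2)) = 0"
    proof -
      have "M * pi * (1 / 2) = real N * pi + pi / 2" by (simp add: M_def field_simps)
      then show ?thesis by (simp only: cos_add) simp
    qed
    ultimately show ?thesis by (simp add: h_def g_def)
  qed
  finally have 1: "\<bar>h x\<bar> \<le> pi / (sin (pi * d))\<^sup>2 / M"
    by (simp add: field_simps)
  have "\<bar>g x\<bar> = \<bar>cos (M * pi * x)\<bar> / (M * sin (pi * x))"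
    using sin_ge[of x] d sd M by (simp add: g_def abs_mult)
  also have "\<dots> \<le> 1 / (M * sin (pi * d))"
    using sin_ge[of x] d sd M by (intro frac_le mult_left_mono) auto
  finally have 2: "\<bar>g x\<bar> \<le> 1 / sin (pi * d) / M"
    by (simp add: field_simps)
  have "S x - pi * (1 / 2 - x) = h x - g x" by (simp add: h_def)
  then have "\<bar>S x - pi * (1 / 2 - x)\<bar> \<le> pi / (sin (pi * d))\<^sup>2 / M + 1 / sin (pi * d) / M"
    using 1 2 by linarith
  then show ?thesis by (simp add: S_def M_def add_divide_distrib)
qed

lemma summable_inverse_squares: "summable (\<lambda>n. 1 / (real n + 1)\<^sup>2)"
  using sums_summable[OF inverse_squares_sums] by (simp add: add.commute)

lemma summable_cos_over_squares:
  fixes x :: real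
  shows "summable (\<lambda>k. cos (2 * pi * real (Suc k) * x) / (real (Suc k))\<^sup>2)"
proof (rule summable_comparison_test')
  show "summable (\<lambda>n. 1 / (real n + 1)\<^sup>2)"
    by (rule summable_inverse_squares)
  show "norm (cos (2 * pi * real (Suc k) * x) / (real (Suc k))\<^sup>2) \<le> 1 / (real k + 1)\<^sup>2" for k
    by (simp add: abs_divide divide_right_mono add.commute)
qed

text \<open>
  Integrating the sawtooth estimate determines the sum on \<open>0 < x \<le> 1 / 2\<close> up to an additive
  constant. Uniform convergence makes the sum continuous at \<open>0\<close>, where Euler's
  \<open>\<pi>\<^sup>2 / 6\<close> fixes the constant; the other half of the interval follows by the symmetry
  \<open>x \<mapsto> 1 - x\<close>.
\<close>
lemma fourier_bernoulli_poly_2: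
  fixes x :: real
  assumes "0 \<le> x" "x \<le> 1"
  shows "(\<lambda>k. cos (2 * pi * real (Suc k) * x) / (real (Suc k))\<^sup>2) sums (pi\<^sup>2 * (x\<^sup>2 - x + 1 / 6))"
proof -
  define f where "f = (\<lambda>x::real. \<Sum>k. cos (2 * pi * real (Suc k) * x) / (real (Suc k))\<^sup>2)"
  define F where "F = (\<lambda>N x::real. \<Sum>k<N. cos (2 * pi * real (Suc k) * x) / (real (Suc k))\<^sup>2)"
  have Ff: "(\<lambda>N. F N x) \<longlonglongrightarrow> f x" for x
    unfolding F_def f_def using summable_cos_over_squares[of x] by (rule summable_LIMSEQ)
  \<comment> \<open>\<open>f\<close> minus the polynomial is constant on \<open>0 < x \<le> 1 / 2\<close>: its partial sums have derivative tending to \<open>0\<close>.\<close>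
  have diff: "f d - pi\<^sup>2 * (d\<^sup>2 - d) = f (1 / 2) + pi\<^sup>2 / 4" if d: "0 < d" "d \<le> 1 / 2" for d
  proof -
    define C where "C = pi / (sin (pi * d))\<^sup>2 + 1 / sin (pi * d)"
    define e where "e = (\<lambda>N x. F N x - pi\<^sup>2 * (x\<^sup>2 - x))"
    have bound: "norm (e N d - e N (1 / 2)) \<le> 2 * pi * C / (2 * real N + 1)" for N
    proof -
      have "norm (e N d - e N (1 / 2)) \<le> (2 * pi * (C / (2 * real N + 1))) * norm (d - 1 / 2)"
      proof (rule field_differentiable_bound)
        show "convex {d..1/2}" by simp
        fix y assume y: "y \<in> {d..1/2}"
        let ?S = "\<Sum>k<N. sin (2 * pi * real (Suc k) * y) / real (Suc k)"
        have dF: "(F N has_field_derivative (\<Sum>k<N. - 2 * pi * (sin (2 * pi * real (Suc k) * y) / real (Suc k)))) (at y)"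
          unfolding F_def
          by (rule DERIV_sum)
             (auto intro!: derivative_eq_intros simp del: of_nat_Suc simp: field_simps power2_eq_square)
        have "(e N has_field_derivative (- 2 * pi * (?S - pi * (1 / 2 - y)))) (at y)"
          unfolding e_def
          by (rule derivative_eq_intros dF refl)+
             (simp add: sum_distrib_left algebra_simps power2_eq_square)
        then show "(e N has_field_derivative (- 2 * pi * (?S - pi * (1 / 2 - y)))) (at y within {d..1/2})"
          by (rule has_field_derivative_at_within)
        show "norm (- 2 * pi * (?S - pi * (1 / 2 - y))) \<le> 2 * pi * (C / (2 * real N + 1))"
        proof -
          have "2 * pi * \<bar>?S - pi * (1 / 2 - y)\<bar> \<le> 2 * pi * (C / (2 * real N + 1))"
            using sawtooth_partial_sum_bound[of d y N] d y
            unfolding C_def by (intro mult_left_mono) auto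
          then show ?thesis by (simp only: real_norm_def abs_mult) simp
        qed
      qed (use d in auto)
      also have "\<dots> \<le> (2 * pi * (C / (2 * real N + 1))) * 1"
      proof (intro mult_left_mono)
        have "sin (pi * d) > 0" using d by (intro sin_gt_zero) auto
        then show "0 \<le> 2 * pi * (C / (2 * real N + 1))" by (auto simp: C_def)
      qed (use d in auto)
      finally show ?thesis by simp
    qed
    have "(\<lambda>N. 2 * pi * C / (2 * real N + 1)) \<longlonglongrightarrow> 0"
      by real_asymp
    then have "(\<lambda>N. e N d - e N (1 / 2)) \<longlonglongrightarrow> 0"
      by (rule Lim_null_comparison[rotated]) (use bound in \<open>auto intro!: always_eventually\<close>)
    moreover have "(\<lambda>N. e N d - e N (1 / 2)) \<longlonglongrightarrow> 
       (f d - pi\<^sup>2 * (d\<^sup>2 - d)) - (f (1 / 2) - pi\<^sup>2 * ((1 / 2)\<^sup>2 - 1 / 2))"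
      unfolding e_def by (intro tendsto_intros Ff)
    ultimately have "(f d - pi\<^sup>2 * (d\<^sup>2 - d)) - (f (1 / 2) - pi\<^sup>2 * ((1 / 2)\<^sup>2 - 1 / 2)) = 0"
      using LIMSEQ_unique by blast
    then show ?thesis by (simp add: field_simps power2_eq_square)
  qed
  have cont: "continuous_on UNIV f"
  proof -
    have "uniform_limit UNIV F f sequentially"
      unfolding F_def f_def
    proof (rule Weierstrass_m_test)
      show "summable (\<lambda>n. 1 / (real n + 1)\<^sup>2)"
        by (rule summable_inverse_squares)
      show "norm (cos (2 * pi * real (Suc k) * x) / (real (Suc k))\<^sup>2) \<le> 1 / (real k + 1)\<^sup>2" for k x
        by (simp add: abs_divide divide_right_mono add.commute)
    qed
    then show ?thesis
      by (rule uniform_limit_theorem[rotated])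
         (auto intro!: always_eventually continuous_intros simp: F_def)
  qed
  have f0: "f 0 = pi\<^sup>2 / 6"
    unfolding f_def using inverse_squares_sums by (simp add: sums_iff add.commute)
  have "((\<lambda>d. f d - pi\<^sup>2 * (d\<^sup>2 - d)) \<longlongrightarrow> f 0 - pi\<^sup>2 * (0\<^sup>2 - 0)) (at_right 0)"
    using cont by (intro tendsto_intros) (simp add: continuous_on_eq_continuous_at isCont_def filterlim_at_split)
  moreover have "((\<lambda>d. f d - pi\<^sup>2 * (d\<^sup>2 - d)) \<longlongrightarrow> f (1 / 2) + pi\<^sup>2 / 4) (at_right 0)"
  proof (rule tendsto_eventually)
    show "\<forall>\<^sub>F d in at_right 0. f d - pi\<^sup>2 * (d\<^sup>2 - d) = f (1 / 2) + pi\<^sup>2 / 4"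
      by (rule eventually_at_rightI[of 0 "1 / 2"]) (auto intro: diff)
  qed
  ultimately have fhalf: "f (1 / 2) + pi\<^sup>2 / 4 = pi\<^sup>2 / 6"
    using f0 tendsto_unique[OF trivial_limit_at_right_real] by fastforce
  have half: "f x = pi\<^sup>2 * (x\<^sup>2 - x + 1 / 6)" if "0 \<le> x" "x \<le> 1 / 2" for x
    using diff[of x] f0 fhalf that by (cases "x = 0") (auto simp: algebra_simps)
  have "f x = pi\<^sup>2 * (x\<^sup>2 - x + 1 / 6)"
  proof (cases "x \<le> 1 / 2")
    case False
    have "cos (2 * pi * real (Suc k) * x) = cos (2 * pi * real (Suc k) * (1 - x))" for k
    proof -
      have "2 * pi * real (Suc k) * (1 - x) = - (2 * pi * real (Suc k) * x) + real (2 * Suc k) * pi"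
        by (simp add: algebra_simps)
      then show ?thesis by (simp only: cos_add cos_npi sin_npi cos_minus) (simp del: of_nat_Suc)
    qed
    then have "f x = f (1 - x)" by (simp add: f_def del: of_nat_Suc)
    also have "\<dots> = pi\<^sup>2 * ((1 - x)\<^sup>2 - (1 - x) + 1 / 6)"
      using False assms by (intro half) auto
    finally show ?thesis by (simp add: power2_eq_square algebra_simps)
  qed (use half assms in auto)
  then show ?thesis
    using summable_sums[OF summable_cos_over_squares[of x]] by (simp add: f_def)
qed

text \<open>
  This series appears under the remainder integral of the Euler-Maclaurin formula.
\<close>
lemma fourier_periodic_bernoulli_2:
  "(\<lambda>k. cos (2 * pi * real (Suc k) * v) / (real (Suc k))\<^sup>2) sums (pi\<^sup>2 * ((frac v)\<^sup>2 - frac v + 1 / 6))"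
proof -
  have "cos (2 * pi * real (Suc k) * v) = cos (2 * pi * real (Suc k) * frac v)" for k
  proof -
    have "2 * pi * real (Suc k) * v = 2 * pi * real (Suc k) * frac v + 2 * pi * of_int (int (Suc k) * \<lfloor>v\<rfloor>)"
      by (simp add: frac_def algebra_simps)
    then show ?thesis
      by (simp only: cos_add cos_int_2pin sin_int_2pin)
  qed
  then show ?thesis
    using fourier_bernoulli_poly_2[of "frac v"] by (simp add: frac_ge_0 less_imp_le[OF frac_lt_1] del: of_nat_Suc)
qed

text \<open>
  The odd-indexed part of the previous series at \<open>v / 4\<close>; the even-indexed part is a quarter
  of the same series at \<open>v / 2\<close>, and the quadratic terms of the two polynomials cancel.
\<close>
lemma fourier_triangle_wave:
  fixes v :: real
  assumes "0 \<le> v" "v \<le> 1"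
  shows "(\<lambda>k. cos (pi * (real k + 1 / 2) * v) / (real k + 1 / 2)\<^sup>2) sums (pi\<^sup>2 / 2 * (1 - v))"
proof -
  define a where "a = (\<lambda>n. if n = 0 then 0 else cos (2 * pi * real n * (v / 4)) / (real n)\<^sup>2)"
  have "(\<lambda>k. a (Suc k)) sums (pi\<^sup>2 * ((v / 4)\<^sup>2 - v / 4 + 1 / 6))"
    unfolding a_def using fourier_bernoulli_poly_2[of "v / 4"] assms by simp
  then have a: "a sums (pi\<^sup>2 * ((v / 4)\<^sup>2 - v / 4 + 1 / 6))"
    by (subst (asm) sums_Suc_iff) (simp add: a_def)
  have "(\<lambda>k. a (2 * Suc k)) sums (pi\<^sup>2 * ((v / 2)\<^sup>2 - v / 2 + 1 / 6) / 4)"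
  proof -
    have "(\<lambda>k. cos (2 * pi * real (Suc k) * (v / 2)) / (real (Suc k))\<^sup>2 / 4) sums (pi\<^sup>2 * ((v / 2)\<^sup>2 - v / 2 + 1 / 6) / 4)"
      using assms by (intro sums_divide fourier_bernoulli_poly_2) auto
    moreover have "cos (2 * pi * real (Suc k) * (v / 2)) / (real (Suc k))\<^sup>2 / 4 = a (2 * Suc k)" for k
    proof -
      have h1: "2 * pi * real (2 * Suc k) * (v / 4) = 2 * pi * real (Suc k) * (v / 2)" by simp
      have h2: "(real (2 * Suc k))\<^sup>2 = 4 * (real (Suc k))\<^sup>2" by (simp add: power2_eq_square algebra_simps)
      show ?thesis
        unfolding a_def h1 h2 by (simp del: of_nat_Suc)
    qed
    ultimately show ?thesis by simp
  qed
  then have even: "(\<lambda>k. a (2 * k)) sums (pi\<^sup>2 * ((v / 2)\<^sup>2 - v / 2 + 1 / 6) / 4)"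
    by (subst (asm) sums_Suc_iff[where f = "\<lambda>k. a (2 * k)"]) (simp add: a_def)
  have "(\<lambda>n. sum a {n * 2..<n * 2 + 2}) sums (pi\<^sup>2 * ((v / 4)\<^sup>2 - v / 4 + 1 / 6))"
    using a by (rule sums_group) simp
  moreover have "sum a {n * 2..<n * 2 + 2} = a (2 * n) + a (2 * n + 1)" for n
    by (simp add: numeral_2_eq_2 mult.commute)
  ultimately have "(\<lambda>n. a (2 * n) + a (2 * n + 1)) sums (pi\<^sup>2 * ((v / 4)\<^sup>2 - v / 4 + 1 / 6))"
    by simp
  from sums_diff[OF this even]
  have "(\<lambda>n. a (2 * n + 1)) sums
      (pi\<^sup>2 * ((v / 4)\<^sup>2 - v / 4 + 1 / 6) - pi\<^sup>2 * ((v / 2)\<^sup>2 - v / 2 + 1 / 6) / 4)"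
    by simp
  also have "pi\<^sup>2 * ((v / 4)\<^sup>2 - v / 4 + 1 / 6) - pi\<^sup>2 * ((v / 2)\<^sup>2 - v / 2 + 1 / 6) / 4 = pi\<^sup>2 * (1 - v) / 8"
    by (simp add: field_simps power2_eq_square)
  finally have "(\<lambda>n. a (2 * n + 1)) sums (pi\<^sup>2 * (1 - v) / 8)" .
  from sums_mult[OF this, of 4]
  have "(\<lambda>n. 4 * a (2 * n + 1)) sums (pi\<^sup>2 / 2 * (1 - v))"
    by (simp add: mult_ac)
  moreover have "4 * a (2 * k + 1) = cos (pi * (real k + 1 / 2) * v) / (real k + 1 / 2)\<^sup>2" for k
  proof -
    have h1: "2 * pi * real (2 * k + 1) * (v / 4) = pi * (real k + 1 / 2) * v"
      by (simp add: field_simps)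
    have h2: "(real (2 * k + 1))\<^sup>2 = 4 * (real k + 1 / 2)\<^sup>2"
      by (simp add: power2_eq_square algebra_simps)
    show ?thesis
      unfolding a_def h1 h2 by simp
  qed
  ultimately show ?thesis by simp
qed

section \<open>Euler numbers as alternating sums\<close>

lemma alternating_odd_reciprocals: "(\<lambda>k. (- 1) ^ k / (real k + 1 / 2)) sums (pi / 2)"
proof -
  have le: "\<bar>1 :: real\<bar> \<le> 1" by simp
  have "(\<lambda>k. (- 1) ^ k * (1 / real (k * 2 + 1) * 1 ^ (k * 2 + 1))) sums arctan 1"
    unfolding arctan_series[OF le] by (rule summable_sums[OF summable_arctan_series[OF le]])
  then have "(\<lambda>k. (- 1) ^ k * (1 / real (k * 2 + 1) * 1 ^ (k * 2 + 1))) sums (pi / 4)"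
    by (simp only: arctan_one)
  from sums_mult[OF this, of 2]
  have "(\<lambda>k. 2 * ((- 1) ^ k * (1 / real (k * 2 + 1) * 1 ^ (k * 2 + 1)))) sums (pi / 2)" by simp
  moreover have "2 * ((- 1) ^ k * (1 / real (k * 2 + 1) * 1 ^ (k * 2 + 1))) = (- 1) ^ k / (real k + 1 / 2)" for k
    by (simp add: field_simps)
  ultimately show ?thesis by (simp only:)
qed

lemma power_over_fact_deriv:
  fixes x :: real
  shows "((\<lambda>v. v ^ Suc n / fact (Suc n)) has_field_derivative x ^ n / fact n) (at x)"
  using DERIV_cdivide[OF DERIV_pow[of "Suc n" x], of "fact (Suc n)"] by (simp del: of_nat_Suc)

text \<open>
  Two integrations by parts lower \<open>q\<close> by one; the boundary terms with a cosine vanish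
  because \<open>cos c = 0\<close>.
\<close>
lemma cos_moment_closed_form:
  fixes c :: real
  assumes c: "c \<noteq> 0" "cos c = 0"
  shows "((\<lambda>v. cos (c * v) * (v ^ (2 * q) / fact (2 * q))) has_integral
     sin c * (\<Sum>j\<le>q. (- 1) ^ j / (c ^ (2 * j + 1) * fact (2 * (q - j))))) {0..1}"
proof (induction q)
  case 0
  have "((\<lambda>v. cos (c * v)) has_integral (sin (c * 1) / c - sin (c * 0) / c)) {0..1}"
    using c by (intro fundamental_theorem_of_calculus)
      (auto intro!: derivative_eq_intros simp flip: has_real_derivative_iff_has_vector_derivative)
  then show ?case by simp
next
  case (Suc q)
  define A where "A = (\<lambda>v. sin (c * v) / c * (v ^ Suc (Suc (2 * q)) / fact (Suc (Suc (2 * q))))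
     + cos (c * v) / c\<^sup>2 * (v ^ Suc (2 * q) / fact (Suc (2 * q))))"
  have "((\<lambda>v. cos (c * v) * (v ^ (2 * q + 2) / fact (2 * q + 2))
      + cos (c * v) * (v ^ (2 * q) / fact (2 * q)) / c\<^sup>2) has_integral (A 1 - A 0)) {0..1}"
  proof (rule fundamental_theorem_of_calculus)
    fix x :: real
    have "(A has_field_derivative (cos (c * x) * (x ^ (2 * q + 2) / fact (2 * q + 2))
      + cos (c * x) * (x ^ (2 * q) / fact (2 * q)) / c\<^sup>2)) (at x)"
      unfolding A_def using c power_over_fact_deriv[of "Suc (2 * q)" x] power_over_fact_deriv[of "2 * q" x]
      by - (rule derivative_eq_intros refl | simp add: power2_eq_square)+
    then show "(A has_vector_derivative (cos (c * x) * (x ^ (2 * q + 2) / fact (2 * q + 2))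
      + cos (c * x) * (x ^ (2 * q) / fact (2 * q)) / c\<^sup>2)) (at x within {0..1})"
      by (simp add: has_real_derivative_iff_has_vector_derivative has_vector_derivative_at_within)
  qed simp
  from has_integral_diff[OF this has_integral_divide[OF Suc.IH, of "c\<^sup>2"]]
  have "((\<lambda>v. cos (c * v) * (v ^ (2 * Suc q) / fact (2 * Suc q))) has_integral
     (A 1 - A 0 - sin c * (\<Sum>j\<le>q. (- 1) ^ j / (c ^ (2 * j + 1) * fact (2 * (q - j)))) / c\<^sup>2)) {0..1}"
    by simp
  also have "A 1 - A 0 - sin c * (\<Sum>j\<le>q. (- 1) ^ j / (c ^ (2 * j + 1) * fact (2 * (q - j)))) / c\<^sup>2
     = sin c * (\<Sum>j\<le>Suc q. (- 1) ^ j / (c ^ (2 * j + 1) * fact (2 * (Suc q - j))))"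
  proof -
    have "(\<Sum>j\<le>Suc q. (- 1) ^ j / (c ^ (2 * j + 1) * fact (2 * (Suc q - j))))
        = 1 / (c * fact (2 * q + 2)) + (\<Sum>j\<le>q. (- 1) ^ Suc j / (c ^ (2 * Suc j + 1) * fact (2 * (q - j))))"
      by (subst sum.atMost_Suc_shift) simp
    also have "(\<Sum>j\<le>q. (- 1) ^ Suc j / (c ^ (2 * Suc j + 1) * fact (2 * (q - j))))
       = - (\<Sum>j\<le>q. (- 1) ^ j / (c ^ (2 * j + 1) * fact (2 * (q - j)))) / c\<^sup>2"
      unfolding sum_divide_distrib sum_negf[symmetric]
      by (intro sum.cong refl) (simp add: power2_eq_square)
    finally have eq: "(\<Sum>j\<le>Suc q. (- 1) ^ j / (c ^ (2 * j + 1) * fact (2 * (Suc q - j))))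
        = 1 / (c * fact (2 * q + 2)) + - (\<Sum>j\<le>q. (- 1) ^ j / (c ^ (2 * j + 1) * fact (2 * (q - j)))) / c\<^sup>2" .
    have "A 1 - A 0 = sin c * (1 / (c * fact (2 * q + 2)))"
      using c by (simp add: A_def)
    then show ?thesis
      unfolding eq distrib_left by simp
  qed
  finally show ?case .
qed

lemma inverse_square_half_integers_summable: "summable (\<lambda>k. 1 / (real k + 1 / 2)\<^sup>2)"
  using sums_summable[OF fourier_triangle_wave[of 0]] by simp

lemma cos_half_integer_pi: "cos (pi * (real k + 1 / 2)) = 0"
  and sin_half_integer_pi: "sin (pi * (real k + 1 / 2)) = (- 1) ^ k"
  using sin_npi[of k] cos_npi[of k] by (simp_all add: distrib_left cos_add sin_add mult.commute)

text \<open>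
  Obtained by integrating the triangle wave against \<open>v^(2 q) / (2 q)!\<close> term by term. In
  terms of the sums \<open>\<Sum>k. (-1)^k / \<kappa>^(2 j + 1)\<close> it compares the coefficients of
  \<open>x^(2 q + 2)\<close> in \<open>cosh x * (1 / cosh x) = 1\<close>, with the partial fraction expansion in
  place of \<open>1 / cosh x\<close>.
\<close>
lemma alternating_odd_power_recurrence:
  "(\<lambda>k. (- 1) ^ k * (\<Sum>j\<le>q. (- 1) ^ j / ((pi * (real k + 1 / 2)) ^ (2 * j + 3) * fact (2 * (q - j)))))
     sums (1 / (2 * fact (2 * q + 2)))"
proof -
  define \<kappa> where "\<kappa> = (\<lambda>k. pi * (real k + 1 / 2))"
  have \<kappa>: "\<kappa> k > 0" "cos (\<kappa> k) = 0" "sin (\<kappa> k) = (- 1) ^ k" for k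
    using cos_half_integer_pi[of k] sin_half_integer_pi[of k] by (auto simp: \<kappa>_def intro!: mult_pos_pos)
  define w where "w = (\<lambda>v::real. v ^ (2 * q) / fact (2 * q))"
  have "(\<lambda>k. (sin (\<kappa> k) * (\<Sum>j\<le>q. (- 1) ^ j / (\<kappa> k ^ (2 * j + 1) * fact (2 * (q - j))))) * (1 / (real k + 1 / 2)\<^sup>2))
     sums integral {0..1} (\<lambda>v. w v * (pi\<^sup>2 / 2 * (1 - v)))"
  proof (rule sums_has_integral_dominated(1)[where h = "\<lambda>_. 1" and M = "\<lambda>k. 1 / (real k + 1 / 2)\<^sup>2"])
    show "((\<lambda>v. cos (\<kappa> k * v) * w v * (1 / (real k + 1 / 2)\<^sup>2)) has_integral
        (sin (\<kappa> k) * (\<Sum>j\<le>q. (- 1) ^ j / (\<kappa> k ^ (2 * j + 1) * fact (2 * (q - j))))) * (1 / (real k + 1 / 2)\<^sup>2)) {0..1}" for k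
      unfolding w_def using \<kappa>[of k] by (intro has_integral_mult_left cos_moment_closed_form) auto
    show "summable (\<lambda>k. 1 / (real k + 1 / 2)\<^sup>2)" by (rule inverse_square_half_integers_summable)
    show "norm (cos (\<kappa> k * v) * w v * (1 / (real k + 1 / 2)\<^sup>2)) \<le> 1 / (real k + 1 / 2)\<^sup>2 * 1" if v: "v \<in> {0..1}" for k v
    proof -
      have "v ^ (2 * q) \<le> 1" using v by (intro power_le_one) auto
      also have "1 \<le> (fact (2 * q) :: real)" by (rule fact_ge_1)
      finally have "\<bar>w v\<bar> \<le> 1" using v by (simp add: w_def)
      then have "\<bar>cos (\<kappa> k * v)\<bar> * \<bar>w v\<bar> * (1 / (real k + 1 / 2)\<^sup>2) \<le> 1 * 1 * (1 / (real k + 1 / 2)\<^sup>2)"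
        by (intro mult_mono) auto
      then show ?thesis by (simp add: abs_mult)
    qed
    show "(\<lambda>k. cos (\<kappa> k * v) * w v * (1 / (real k + 1 / 2)\<^sup>2)) sums (w v * (pi\<^sup>2 / 2 * (1 - v)))" if "v \<in> {0..1}" for v
      using sums_mult[OF fourier_triangle_wave[of v], of "w v"] that by (simp add: \<kappa>_def mult_ac)
  qed auto
  also have "integral {0..1} (\<lambda>v. w v * (pi\<^sup>2 / 2 * (1 - v))) = pi\<^sup>2 * (1 / (2 * fact (2 * q + 2)))"
  proof -
    define A where "A = (\<lambda>v::real. pi\<^sup>2 / 2 * (v ^ Suc (2 * q) / fact (Suc (2 * q))
       - real (Suc (2 * q)) * (v ^ Suc (Suc (2 * q)) / fact (Suc (Suc (2 * q))))))"
    have "((\<lambda>v. w v * (pi\<^sup>2 / 2 * (1 - v))) has_integral (A 1 - A 0)) {0..1}"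
    proof (rule fundamental_theorem_of_calculus)
      fix x :: real
      have eq: "real (Suc (2 * q)) * (x ^ Suc (2 * q) / fact (Suc (2 * q))) = x * w x"
        by (simp add: w_def del: of_nat_Suc)
      have "(A has_field_derivative pi\<^sup>2 / 2 * (w x - real (Suc (2 * q)) * (x ^ Suc (2 * q) / fact (Suc (2 * q))))) (at x)"
        unfolding A_def w_def by (intro DERIV_cmult DERIV_diff power_over_fact_deriv)
      then have "(A has_field_derivative w x * (pi\<^sup>2 / 2 * (1 - x))) (at x)"
        unfolding eq by (simp add: algebra_simps)
      then show "(A has_vector_derivative w x * (pi\<^sup>2 / 2 * (1 - x))) (at x within {0..1})"
        by (simp add: has_real_derivative_iff_has_vector_derivative has_vector_derivative_at_within)
    qed simp
    also have "A 1 - A 0 = pi\<^sup>2 * (1 / (2 * fact (2 * q + 2)))"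
      by (simp add: A_def divide_simps)
    finally show ?thesis by (rule integral_unique)
  qed
  finally have *: "(\<lambda>k. (sin (\<kappa> k) * (\<Sum>j\<le>q. (- 1) ^ j / (\<kappa> k ^ (2 * j + 1) * fact (2 * (q - j))))) * (1 / (real k + 1 / 2)\<^sup>2))
     sums (pi\<^sup>2 * (1 / (2 * fact (2 * q + 2))))" .
  have \<kappa>2: "(\<kappa> k)\<^sup>2 = (real k + 1 / 2)\<^sup>2 * pi\<^sup>2" for k
    by (simp add: \<kappa>_def power_mult_distrib)
  from sums_divide[OF *, of "pi\<^sup>2"]
  have "(\<lambda>k. (- 1) ^ k * (\<Sum>j\<le>q. (- 1) ^ j / (\<kappa> k ^ (2 * j + 1) * fact (2 * (q - j)))) / (\<kappa> k)\<^sup>2)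
      sums (1 / (2 * fact (2 * q + 2)))"
    unfolding \<kappa>(3) \<kappa>2 by simp
  moreover have "(- 1) ^ k * (\<Sum>j\<le>q. (- 1) ^ j / (\<kappa> k ^ (2 * j + 1) * fact (2 * (q - j)))) / (\<kappa> k)\<^sup>2
      = (- 1) ^ k * (\<Sum>j\<le>q. (- 1) ^ j / (\<kappa> k ^ (2 * j + 3) * fact (2 * (q - j))))" for k
    unfolding times_divide_eq_right[symmetric] sum_divide_distrib
    by (intro arg_cong[of _ _ "(*) _"] sum.cong refl) (simp add: power_add power2_eq_square power3_eq_cube mult_ac)
  ultimately show ?thesis by (simp add: \<kappa>_def)
qed

lemma alternating_odd_power_summable:
  "summable (\<lambda>k. (- 1) ^ k / (real k + 1 / 2) ^ (2 * j + 1))"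
proof -
  have "summable (\<lambda>k. (- 1) ^ k * (1 / (real k + 1 / 2) ^ (2 * j + 1)))"
  proof (rule summable_Leibniz(1))
    have "(\<lambda>k. (1 / (real k + 1 / 2)) ^ (2 * j + 1)) \<longlonglongrightarrow> 0 ^ (2 * j + 1)"
      by (rule tendsto_power) real_asymp
    then show "(\<lambda>k. 1 / (real k + 1 / 2) ^ (2 * j + 1)) \<longlonglongrightarrow> 0"
      by (simp only: power_one_over) simp
    show "monoseq (\<lambda>k. 1 / (real k + 1 / 2) ^ (2 * j + 1))"
      by (intro decseq_imp_monoseq decseq_SucI divide_left_mono power_mono mult_pos_pos zero_less_power) auto
  qed
  then show ?thesis by simp
qed

text \<open>
  The Euler numbers are characterised by the convolution of their generating function with the
  power series of \<open>cosh\<close>, which involves even indices only.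
\<close>
lemma euler_number_eqI:
  defines "C \<equiv> fps_const (1 / 2) * (fps_exp 1 + fps_exp (- 1)) :: real fps"
  assumes e0: "e 0 = 1"
    and odd: "\<And>n. odd n \<Longrightarrow> e n = 0"
    and rec: "\<And>q. (\<Sum>j\<le>Suc q. e (2 * j) / fact (2 * (Suc q - j))) = 0"
  shows "euler_number n = fact n * e n"
proof -
  have Cn: "fps_nth C n = (if even n then 1 / fact n else 0)" for n
    by (simp add: C_def)
  have C0: "fps_nth C 0 \<noteq> 0" by (simp add: Cn)
  have "Abs_fps e * C = 1"
  proof (rule fps_ext)
    fix n
    have eq: "fps_nth (Abs_fps e * C) n = (\<Sum>i=0..n. e i * fps_nth C (n - i))"
      by (simp add: fps_mult_nth)
    show "fps_nth (Abs_fps e * C) n = fps_nth 1 n"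
    proof (cases "even n")
      case False
      have "e i * fps_nth C (n - i) = 0" if "i \<le> n" for i
        using False odd[of i] that by (auto simp: Cn)
      then have "(\<Sum>i=0..n. e i * fps_nth C (n - i)) = 0"
        by (intro sum.neutral) auto
      then show ?thesis using False eq by (auto simp: odd_pos)
    next
      case True
      then obtain m where m: "n = 2 * m" by auto
      have "(\<Sum>i=0..n. e i * fps_nth C (n - i)) = (\<Sum>i\<in>(*) 2 ` {..m}. e i * fps_nth C (n - i))"
      proof (rule sum.mono_neutral_right)
        show "\<forall>i\<in>{0..n} - (*) 2 ` {..m}. e i * fps_nth C (n - i) = 0"
        proof
          fix i assume i: "i \<in> {0..n} - (*) 2 ` {..m}"
          have "odd i"
          proof
            assume "even i"
            then obtain j where "i = 2 * j" by auto
            with i m show False by auto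
          qed
          then show "e i * fps_nth C (n - i) = 0" by (simp add: odd)
        qed
      qed (auto simp: m)
      also have "\<dots> = (\<Sum>j\<le>m. e (2 * j) / fact (2 * (m - j)))"
        by (subst sum.reindex) (auto simp: inj_on_def m Cn simp flip: diff_mult_distrib2)
      also have "\<dots> = (if m = 0 then 1 else 0)"
        using e0 rec[of "m - 1"] by (cases m) auto
      finally show ?thesis using eq m by auto
    qed
  qed
  then have "inverse C = Abs_fps e"
    using C0 by (metis fps_inverse_unique mult.commute)
  then show ?thesis by (simp add: euler_number_def C_def)
qed

text \<open>
  Both sides satisfy the recurrence that characterises the Euler numbers; the Leibniz series
  provides its initial value.
\<close>
lemma alternating_odd_power_sum:
  "(\<lambda>k. (- 1) ^ k / (real k + 1 / 2) ^ (2 * j + 1)) sums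
     ((- 1) ^ j * pi ^ (2 * j + 1) * euler_number (2 * j) / (2 * fact (2 * j)))"
proof -
  define c where "c = (\<lambda>j. \<Sum>k. (- 1) ^ k / (real k + 1 / 2) ^ (2 * j + 1))"
  have c: "(\<lambda>k. (- 1) ^ k / (real k + 1 / 2) ^ (2 * j + 1)) sums c j" for j
    unfolding c_def by (rule summable_sums[OF alternating_odd_power_summable])
  define e where "e = (\<lambda>n. if even n then 2 * (- 1) ^ (n div 2) * c (n div 2) / pi ^ (n + 1) else 0)"
  have "euler_number n = fact n * e n" for n
  proof (rule euler_number_eqI)
    have "c 0 = pi / 2"
      using c[of 0] alternating_odd_reciprocals sums_unique2 by fastforce
    then show e0: "e 0 = 1" by (simp add: e_def)
    show "e n = 0" if "odd n" for n using that by (simp add: e_def)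
    show "(\<Sum>j\<le>Suc q. e (2 * j) / fact (2 * (Suc q - j))) = 0" for q
    proof -
      have "(\<lambda>k. \<Sum>j\<le>q. ((- 1) ^ k / (real k + 1 / 2) ^ (2 * Suc j + 1)) * ((- 1) ^ j / (pi ^ (2 * j + 3) * fact (2 * (q - j)))))
         sums (\<Sum>j\<le>q. c (Suc j) * ((- 1) ^ j / (pi ^ (2 * j + 3) * fact (2 * (q - j)))))"
        by (intro sums_sum sums_mult2 c)
      moreover have "(\<Sum>j\<le>q. ((- 1) ^ k / (real k + 1 / 2) ^ (2 * Suc j + 1)) * ((- 1) ^ j / (pi ^ (2 * j + 3) * fact (2 * (q - j)))))
         = (- 1) ^ k * (\<Sum>j\<le>q. (- 1) ^ j / ((pi * (real k + 1 / 2)) ^ (2 * j + 3) * fact (2 * (q - j))))" for k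
        unfolding sum_distrib_left
        by (intro sum.cong refl) (simp add: power_mult_distrib numeral_3_eq_3 mult_ac)
      ultimately have "(\<Sum>j\<le>q. c (Suc j) * ((- 1) ^ j / (pi ^ (2 * j + 3) * fact (2 * (q - j))))) = 1 / (2 * fact (2 * q + 2))"
        using alternating_odd_power_recurrence[of q] sums_unique2 by fastforce
      moreover have "(\<Sum>j\<le>q. e (2 * Suc j) / fact (2 * (q - j)))
          = - 2 * (\<Sum>j\<le>q. c (Suc j) * ((- 1) ^ j / (pi ^ (2 * j + 3) * fact (2 * (q - j)))))"
        unfolding sum_distrib_left
        by (intro sum.cong refl) (simp add: e_def numeral_3_eq_3)
      moreover have "(\<Sum>j\<le>Suc q. e (2 * j) / fact (2 * (Suc q - j)))
          = 1 / fact (2 * q + 2) + (\<Sum>j\<le>q. e (2 * Suc j) / fact (2 * (q - j)))"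
        by (subst sum.atMost_Suc_shift) (simp add: e0)
      ultimately show ?thesis by simp
    qed
  qed
  from this[of "2 * j"] have "c j = (- 1) ^ j * pi ^ (2 * j + 1) * euler_number (2 * j) / (2 * fact (2 * j))"
    by (simp add: e_def)
  then show ?thesis using c[of j] by simp
qed

section \<open>The generalized exponential integral\<close>

definition expint_kernel :: "complex \<Rightarrow> complex \<Rightarrow> real \<Rightarrow> complex" where
  "expint_kernel z t v = of_real v powr (- t) * exp (- z * of_real v)"

lemma norm_expint_kernel_le:
  assumes "v > 0" "Re z \<ge> 0"
  shows "norm (expint_kernel z t v) \<le> v powr (- Re t)"
proof -
  have "exp (- (Re z * v)) \<le> 1" using assms by simp
  then have "v powr (- Re t) * exp (- (Re z * v)) \<le> v powr (- Re t) * 1"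
    by (intro mult_left_mono) auto
  then show ?thesis
    using assms by (simp add: expint_kernel_def norm_mult norm_powr_real_powr)
qed

lemma powr_of_real_eq_exp: "v > 0 \<Longrightarrow> complex_of_real v powr a = exp (a * of_real (ln v))"
  by (simp add: powr_def Ln_of_real)

lemma expint_kernel_eq_exp:
  "v > 0 \<Longrightarrow> expint_kernel z t v = exp (- t * of_real (ln v)) * exp (- z * of_real v)"
  by (simp add: expint_kernel_def powr_of_real_eq_exp)

lemma continuous_on_expint_kernel:
  assumes "S \<subseteq> {0<..}"
  shows "continuous_on S (expint_kernel z t)"
proof -
  have "continuous_on S (\<lambda>v. exp (- t * of_real (ln v)) * exp (- z * of_real v))"
    using assms by (intro continuous_intros) auto
  then show ?thesis
    by (rule continuous_on_eq) (use assms in \<open>auto simp: expint_kernel_eq_exp\<close>)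
qed

text \<open>
  Integration by parts. Letting \<open>b\<close> tend to infinity turns it into the recurrence in the first
  argument of the exponential integral, which serves both for the analytic continuation and for
  passing from \<open>n\<close> to \<open>n + 1\<close> in the expansion.
\<close>
lemma expint_kernel_parts:
  assumes "b \<ge> 1"
  shows "z * integral {1..b} (expint_kernel z t) + t * integral {1..b} (expint_kernel z (t + 1))
    = exp (- z) - expint_kernel z t b"
proof -
  have int: "expint_kernel z s integrable_on {1..b}" for s
    by (intro integrable_continuous_interval continuous_on_expint_kernel) auto
  have "((\<lambda>v. - t * expint_kernel z (t + 1) v - z * expint_kernel z t v) has_integral
     (expint_kernel z t b - expint_kernel z t 1)) {1..b}"
  proof (rule fundamental_theorem_of_calculus)
    fix x assume x: "x \<in> {1..b}"
    have "((\<lambda>w. w powr (- t) * exp (- z * w)) has_field_derivative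
       (- t * expint_kernel z (t + 1) x - z * expint_kernel z t x)) (at (of_real x))"
    proof -
      have e: "- t - 1 = - 1 - t" by simp
      show ?thesis
        using x
        by (auto intro!: derivative_eq_intros has_field_derivative_powr
            simp: expint_kernel_def complex_nonpos_Reals_iff algebra_simps e)
    qed
    from has_vector_derivative_real_field[OF this, of "{1..b}"]
    show "(expint_kernel z t has_vector_derivative
       (- t * expint_kernel z (t + 1) x - z * expint_kernel z t x)) (at x within {1..b})"
      by (simp add: expint_kernel_def[abs_def])
  qed (use assms in auto)
  moreover have "((\<lambda>v. - t * expint_kernel z (t + 1) v - z * expint_kernel z t v) has_integral
     (- t * integral {1..b} (expint_kernel z (t + 1)) - z * integral {1..b} (expint_kernel z t))) {1..b}"
    by (intro has_integral_diff has_integral_mult_right integrable_integral int)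
  ultimately have "- t * integral {1..b} (expint_kernel z (t + 1)) - z * integral {1..b} (expint_kernel z t)
     = expint_kernel z t b - expint_kernel z t 1"
    using has_integral_unique by blast
  moreover have "expint_kernel z t 1 = exp (- z)" by (simp add: expint_kernel_def)
  ultimately show ?thesis by (simp add: algebra_simps)
qed

lemma expint_kernel_tail:
  assumes b: "b > 0" and t: "Re t > 1" and z: "Re z \<ge> 0"
  shows "expint_kernel z t integrable_on {b..}"
    and "norm (integral {b..} (expint_kernel z t)) \<le> b powr (1 - Re t) / (Re t - 1)"
proof -
  have int: "((\<lambda>v. v powr (- Re t)) has_integral (b powr (1 - Re t) / (Re t - 1))) {b..}"
    using has_integral_powr_to_inf[of "- Re t" b] t b by (simp add: minus_divide_right)
  have le: "norm (expint_kernel z t v) \<le> v powr (- Re t)" if "v \<in> {b..}" for v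
    using that b z by (intro norm_expint_kernel_le) auto
  show 1: "expint_kernel z t integrable_on {b..}"
  proof (rule measurable_bounded_by_integrable_imp_integrable)
    show "expint_kernel z t \<in> borel_measurable (lebesgue_on {b..})"
      by (intro continuous_imp_measurable_on_sets_lebesgue continuous_on_expint_kernel) (use b in auto)
    show "(\<lambda>v. v powr (- Re t)) integrable_on {b..}" using int by blast
  qed (use le in auto)
  show "norm (integral {b..} (expint_kernel z t)) \<le> b powr (1 - Re t) / (Re t - 1)"
    using integral_norm_bound_integral[OF 1 _ le] int by (auto simp: has_integral_iff)
qed

lemma expint_kernel_split:
  assumes b: "b \<ge> 1" and t: "Re t > 1" and z: "Re z \<ge> 0"
  shows "integral {1..} (expint_kernel z t) = integral {1..b} (expint_kernel z t) + integral {b..} (expint_kernel z t)"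
proof -
  have "(expint_kernel z t has_integral integral {1..b} (expint_kernel z t) + integral {b..} (expint_kernel z t)) ({1..b} \<union> {b..})"
  proof (rule has_integral_Un)
    show "(expint_kernel z t has_integral integral {1..b} (expint_kernel z t)) {1..b}"
      by (intro integrable_integral integrable_continuous_interval continuous_on_expint_kernel) auto
    show "(expint_kernel z t has_integral integral {b..} (expint_kernel z t)) {b..}"
      using assms by (intro integrable_integral expint_kernel_tail) auto
    have "{1..b} \<inter> {b..} = {b}" using b by auto
    then show "negligible ({1..b} \<inter> {b..})" by simp
  qed
  moreover have "{1..b} \<union> {b..} = {1..}" using b by auto
  ultimately show ?thesis by (simp add: integral_unique)
qed

lemma expint_kernel_integral_limit:
  assumes t: "Re t > 1" and z: "Re z \<ge> 0"
  shows "((\<lambda>b. integral {1..b} (expint_kernel z t)) \<longlongrightarrow> integral {1..} (expint_kernel z t)) at_top"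
proof (rule Lim_transform)
  show "((\<lambda>b. integral {1..} (expint_kernel z t)) \<longlongrightarrow> integral {1..} (expint_kernel z t)) at_top"
    by simp
  have "((\<lambda>b. b powr (1 - Re t) / (Re t - 1)) \<longlongrightarrow> 0) at_top"
    using t by real_asymp
  then show "((\<lambda>b. integral {1..b} (expint_kernel z t) - integral {1..} (expint_kernel z t)) \<longlongrightarrow> 0) at_top"
  proof (rule Lim_null_comparison[rotated])
    show "\<forall>\<^sub>F b in at_top. norm (integral {1..b} (expint_kernel z t) - integral {1..} (expint_kernel z t))
         \<le> b powr (1 - Re t) / (Re t - 1)"
      using eventually_ge_at_top[of 1]
    proof eventually_elim
      case (elim b)
      then show ?case
        using expint_kernel_split[OF elim t z] expint_kernel_tail(2)[of b t z] t z by simp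
    qed
  qed
qed

lemma expint_kernel_tendsto_0:
  assumes "Re t > 0" "Re z \<ge> 0"
  shows "(expint_kernel z t \<longlongrightarrow> 0) at_top"
proof (rule Lim_null_comparison)
  show "((\<lambda>b. b powr (- Re t)) \<longlongrightarrow> 0) at_top" using assms by real_asymp
  show "\<forall>\<^sub>F b in at_top. norm (expint_kernel z t b) \<le> b powr (- Re t)"
    using eventually_gt_at_top[of 0] by eventually_elim (use assms norm_expint_kernel_le in auto)
qed

lemma holomorphic_integral_expint_kernel:
  "(\<lambda>t. integral {1..b} (expint_kernel z t)) holomorphic_on UNIV"
  unfolding holomorphic_on_def
proof (intro ballI)
  fix t0 :: complex
  have "(\<lambda>t. integral (cbox 1 b) (expint_kernel z t)) field_differentiable (at t0 within UNIV)"
  proof (rule leibniz_rule_field_differentiable)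
    fix t v assume "v \<in> cbox 1 b"
    then have v: "v > 0" by auto
    have "((\<lambda>t. exp (- t * of_real (ln v)) * exp (- z * of_real v)) has_field_derivative
        (- of_real (ln v) * (exp (- t * of_real (ln v)) * exp (- z * of_real v)))) (at t)"
      by (auto intro!: derivative_eq_intros)
    then show "((\<lambda>t. expint_kernel z t v) has_field_derivative
        (- of_real (ln v) * (exp (- t * of_real (ln v)) * exp (- z * of_real v)))) (at t within UNIV)"
      using v by (simp add: expint_kernel_eq_exp)
  next
    show "continuous_on (UNIV \<times> cbox 1 b) (\<lambda>(t, v). - of_real (ln v) * (exp (- t * of_real (ln v)) * exp (- z * of_real v)))"
      unfolding split_beta by (intro continuous_intros) auto
    show "expint_kernel z t integrable_on cbox 1 b" for t
      unfolding cbox_interval by (intro integrable_continuous_interval continuous_on_expint_kernel) auto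
  qed auto
  then show "(\<lambda>t. integral {1..b} (expint_kernel z t)) field_differentiable (at t0 within UNIV)"
    by simp
qed

lemma holomorphic_integral_expint_kernel_to_inf:
  assumes z: "Re z \<ge> 0"
  shows "(\<lambda>t. integral {1..} (expint_kernel z t)) holomorphic_on {t. Re t > 1}"
proof (rule holomorphic_uniform_sequence[where f = "\<lambda>n t. integral {1..real n + 1} (expint_kernel z t)"])
  show "open {t. Re t > 1}" by (rule open_halfspace_Re_gt)
  show "(\<lambda>t. integral {1..real n + 1} (expint_kernel z t)) holomorphic_on {t. Re t > 1}" for n
    using holomorphic_integral_expint_kernel by (rule holomorphic_on_subset) auto
  fix t0 assume "t0 \<in> {t. Re t > 1}"
  then have t0: "Re t0 > 1" by simp
  define d where "d = (Re t0 - 1) / 2"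
  have d: "d > 0" using t0 by (simp add: d_def)
  have Re: "Re t \<ge> 1 + d" if "t \<in> cball t0 d" for t
  proof -
    have "\<bar>Re (t0 - t)\<bar> \<le> norm (t0 - t)" by (rule abs_Re_le_cmod)
    then show ?thesis using that by (auto simp: dist_norm d_def field_simps)
  qed
  have "uniform_limit (cball t0 d) (\<lambda>n t. integral {1..real n + 1} (expint_kernel z t))
      (\<lambda>t. integral {1..} (expint_kernel z t)) sequentially"
  proof (rule uniform_limitI)
    fix e :: real assume e: "e > 0"
    have "(\<lambda>n. (real n + 1) powr (- d) / d) \<longlonglongrightarrow> 0" using d by real_asymp
    from order_tendstoD(2)[OF this e]
    show "\<forall>\<^sub>F n in sequentially. \<forall>t\<in>cball t0 d.
        dist (integral {1..real n + 1} (expint_kernel z t)) (integral {1..} (expint_kernel z t)) < e"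
    proof eventually_elim
      case (elim n)
      show ?case
      proof
        fix t assume t: "t \<in> cball t0 d"
        have R: "Re t > 1" using Re[OF t] d by simp
        have "dist (integral {1..real n + 1} (expint_kernel z t)) (integral {1..} (expint_kernel z t))
            = norm (integral {real n + 1..} (expint_kernel z t))"
          using expint_kernel_split[of "real n + 1" t z] R z by (simp add: dist_norm)
        also have "\<dots> \<le> (real n + 1) powr (1 - Re t) / (Re t - 1)"
          using R z by (intro expint_kernel_tail) auto
        also have "\<dots> \<le> (real n + 1) powr (- d) / d"
          using Re[OF t] d by (intro frac_le powr_mono) auto
        finally show "dist (integral {1..real n + 1} (expint_kernel z t)) (integral {1..} (expint_kernel z t)) < e"
          using elim by simp
      qed
    qed
  qed
  moreover have "cball t0 d \<subseteq> {t. Re t > 1}" using Re d by fastforce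
  ultimately show "\<exists>d>0. cball t0 d \<subseteq> {t. Re t > 1} \<and> uniform_limit (cball t0 d)
     (\<lambda>n t. integral {1..real n + 1} (expint_kernel z t)) (\<lambda>t. integral {1..} (expint_kernel z t)) sequentially"
    using d by blast
qed

text \<open>
  The continuation of the exponential integral to \<open>Re t > 1 - N\<close>: the absolutely convergent
  integral for \<open>N = 0\<close>, extended by one unit to the left with each use of the recurrence.
\<close>
primrec expint_ext :: "complex \<Rightarrow> nat \<Rightarrow> complex \<Rightarrow> complex" where
  "expint_ext z 0 t = integral {1..} (expint_kernel z t)"
| "expint_ext z (Suc N) t = (exp (- z) - t * expint_ext z N (t + 1)) / z"

context
  fixes z :: complex
  assumes z: "Re z \<ge> 0" "z \<noteq> 0"
begin

text \<open>
  A single integration by parts makes the conditionally convergent integral for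
  \<open>0 < Re t \<le> 1\<close> absolutely convergent.
\<close>
lemma expint_kernel_integral_limit_ext:
  assumes t: "Re t > 0"
  shows "((\<lambda>b. integral {1..b} (expint_kernel z t)) \<longlongrightarrow> expint_ext z 1 t) at_top"
proof (rule Lim_transform_eventually)
  show "((\<lambda>b. (exp (- z) - expint_kernel z t b - t * integral {1..b} (expint_kernel z (t + 1))) / z)
    \<longlongrightarrow> expint_ext z 1 t) at_top"
    using t z expint_kernel_tendsto_0[of t z] expint_kernel_integral_limit[of "t + 1" z]
    by (auto intro!: tendsto_eq_intros)
  show "\<forall>\<^sub>F b in at_top. (exp (- z) - expint_kernel z t b - t * integral {1..b} (expint_kernel z (t + 1))) / z
      = integral {1..b} (expint_kernel z t)"
    using eventually_ge_at_top[of 1]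
  proof eventually_elim
    case (elim b)
    then show ?case using expint_kernel_parts[OF elim, of z t] z by (simp add: field_simps)
  qed
qed

lemma expint_ext_Suc_eq:
  "Re t > 1 - real N \<Longrightarrow> expint_ext z (Suc N) t = expint_ext z N t"
proof (induction N arbitrary: t)
  case 0
  then have t: "Re t > 1" by simp
  have "((\<lambda>b. integral {1..b} (expint_kernel z t)) \<longlongrightarrow> expint_ext z (Suc 0) t) at_top"
    using expint_kernel_integral_limit_ext[of t] t by simp
  moreover have "((\<lambda>b. integral {1..b} (expint_kernel z t)) \<longlongrightarrow> expint_ext z 0 t) at_top"
    using expint_kernel_integral_limit[of t z] t z by simp
  ultimately show ?case
    using tendsto_unique trivial_limit_at_top_linorder by blast
next
  case (Suc N)
  have "expint_ext z (Suc N) (t + 1) = expint_ext z N (t + 1)"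
    using Suc.prems by (intro Suc.IH) simp
  then show ?case by (simp only: expint_ext.simps(2))
qed

lemma expint_ext_eq:
  assumes "Re t > 1 - real N" "Re t > 1 - real M"
  shows "expint_ext z M t = expint_ext z N t"
proof -
  have "expint_ext z (K + j) t = expint_ext z K t" if "Re t > 1 - real K" for K j
    by (induction j) (use that expint_ext_Suc_eq in auto)
  from this[of N M] this[of M N] show ?thesis using assms by (simp add: add.commute)
qed

lemma holomorphic_expint_ext:
  "expint_ext z N holomorphic_on {t. Re t > 1 - real N}"
proof (induction N)
  case 0
  then show ?case using holomorphic_integral_expint_kernel_to_inf[of z] z by simp
next
  case (Suc N)
  have "(expint_ext z N \<circ> (\<lambda>t. t + 1)) holomorphic_on {t. Re t > 1 - real (Suc N)}"
    by (rule holomorphic_on_compose_gen[OF _ Suc.IH]) (auto intro!: holomorphic_intros)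
  then show ?case
    using z by (auto intro!: holomorphic_intros simp: o_def)
qed

text \<open>
  The partial continuations agree wherever they are defined, so together they form an entire
  function; it has the limits required of the exponential integral, which is therefore equal
  to it.
\<close>
lemma exp_integral_eq_ext: "Re s > 1 - real N \<Longrightarrow> exp_integral s z = expint_ext z N s"
    and exp_integral_holomorphic: "(\<lambda>s. exp_integral s z) holomorphic_on UNIV"
proof -
  define F where "F = (\<lambda>t. expint_ext z (nat \<lceil>2 - Re t\<rceil>) t)"
  have F: "F t = expint_ext z N t" if "Re t > 1 - real N" for N t
    unfolding F_def
  proof (rule expint_ext_eq)
    have "2 - Re t \<le> real_of_int \<lceil>2 - Re t\<rceil>" by simp
    also have "\<dots> \<le> real (nat \<lceil>2 - Re t\<rceil>)" by linarith
    finally show "Re t > 1 - real (nat \<lceil>2 - Re t\<rceil>)" by simp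
  qed fact
  have holo: "F holomorphic_on UNIV"
  proof -
    have "F holomorphic_on (\<Union>N. {t. Re t > 1 - real N})"
    proof (rule holomorphic_on_UN_open)
      show "F holomorphic_on {t. Re t > 1 - real N}" for N
        using holomorphic_expint_ext[of N] by (rule holomorphic_transform) (simp add: F)
      show "open {t. Re t > 1 - real N}" for N by (rule open_halfspace_Re_gt)
    qed
    also have "(\<Union>N. {t. Re t > 1 - real N}) = UNIV"
    proof -
      have "\<exists>N. Re t > 1 - real N" for t
        using reals_Archimedean2[of "1 - Re t"] by (auto simp: algebra_simps)
      then show ?thesis by auto
    qed
    finally show ?thesis .
  qed
  have eq: "exp_integral s z = F s" for s
  proof (rule exp_integral_eqI[OF holo])
    fix t :: complex assume t: "Re t > 0"
    show "((\<lambda>b. integral {1..b} (\<lambda>v::real. of_real v powr (- t) * exp (- z * of_real v))) \<longlongrightarrow> F t) at_top"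
      using expint_kernel_integral_limit_ext[OF t] F[of 1 t] t by (simp add: expint_kernel_def[abs_def])
  qed
  show "exp_integral s z = expint_ext z N s" if "Re s > 1 - real N" using eq F that by simp
  show "(\<lambda>s. exp_integral s z) holomorphic_on UNIV" using holo by (simp add: eq)
qed

lemma exp_integral_recurrence:
  "s * exp_integral (s + 1) z = exp (- z) - z * exp_integral s z"
proof -
  obtain N where N: "Re s > 1 - real N"
    using reals_Archimedean2[of "1 - Re s"] by (auto simp: algebra_simps)
  have "exp_integral s z = expint_ext z (Suc N) s"
    using N by (intro exp_integral_eq_ext) auto
  moreover have "exp_integral (s + 1) z = expint_ext z N (s + 1)"
    using N by (intro exp_integral_eq_ext) auto
  ultimately show ?thesis using z by (simp add: field_simps)
qed

lemma exp_integral_has_integral: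
  assumes "Re s > 1"
  shows "(expint_kernel z s has_integral exp_integral s z) {1..}"
  using exp_integral_eq_ext[of 0 s] expint_kernel_tail(1)[of 1 s z] assms z
  by (simp add: has_integral_iff)

lemma exp_integral_limit:
  assumes "Re s > 0"
  shows "((\<lambda>b. integral {1..b} (expint_kernel z s)) \<longlongrightarrow> exp_integral s z) at_top"
  using exp_integral_eq_ext[of 1 s] expint_kernel_integral_limit_ext[of s] assms by simp

end

text \<open>
  Uniformity in \<open>z\<close> is what makes series over \<open>z\<close> holomorphic. For \<open>Re s \<ge> 2\<close> the bound
  comes from the integral; each use of the recurrence, in which \<open>|z| \<ge> 1\<close> is divided out,
  moves it one unit to the left.
\<close>
lemma exp_integral_bound_halfplane:
  "\<exists>B. \<forall>s z. norm s \<le> R \<and> Re s \<ge> 2 - real N \<and> norm z \<ge> 1 \<and> Re z \<ge> 0 \<longrightarrow> norm (exp_integral s z) \<le> B"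
proof (induction N arbitrary: R)
  case 0
  have "norm (exp_integral s z) \<le> 1" if "Re s \<ge> 2" "norm z \<ge> 1" "Re z \<ge> 0" for s z
  proof -
    have "norm (exp_integral s z) \<le> 1 powr (1 - Re s) / (Re s - 1)"
      using exp_integral_has_integral[of z s] expint_kernel_tail(2)[of 1 s z] that
      by (cases "z = 0") (auto simp: has_integral_iff)
    also have "\<dots> \<le> 1" using that by simp
    finally show ?thesis .
  qed
  then show ?case by (intro exI[of _ 1]) auto
next
  case (Suc N)
  from Suc.IH[of "R + 1"] obtain B where B:
    "\<And>s z. norm s \<le> R + 1 \<Longrightarrow> Re s \<ge> 2 - real N \<Longrightarrow> norm z \<ge> 1 \<Longrightarrow> Re z \<ge> 0 \<Longrightarrow> norm (exp_integral s z) \<le> B"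
    by blast
  show ?case
  proof (intro exI allI impI, elim conjE)
    fix s z :: complex
    assume A: "norm s \<le> R" "Re s \<ge> 2 - real (Suc N)" "norm z \<ge> 1" "Re z \<ge> 0"
    have z: "z \<noteq> 0" using A by auto
    have "norm (s + 1) \<le> R + 1" using A norm_triangle_ineq[of s 1] by simp
    then have b: "norm (exp_integral (s + 1) z) \<le> B" using A by (intro B) auto
    have "exp_integral s z = (exp (- z) - s * exp_integral (s + 1) z) / z"
      using exp_integral_recurrence[of z s] A z by (simp add: field_simps)
    then have "norm (exp_integral s z) = norm (exp (- z) - s * exp_integral (s + 1) z) / norm z"
      by (simp add: norm_divide)
    also have "\<dots> \<le> norm (exp (- z) - s * exp_integral (s + 1) z) / 1"
      using A by (intro divide_left_mono) auto
    also have "\<dots> \<le> norm (exp (- z)) + norm s * norm (exp_integral (s + 1) z)"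
      unfolding norm_mult[symmetric] div_by_1 by (rule norm_triangle_ineq4)
    also have "\<dots> \<le> 1 + R * B"
      using A b by (intro add_mono mult_mono) (auto intro: order_trans[OF norm_ge_zero])
    finally show "norm (exp_integral s z) \<le> 1 + R * B" .
  qed
qed

lemma exp_integral_bound:
  obtains B where "\<And>s z. norm s \<le> R \<Longrightarrow> norm z \<ge> 1 \<Longrightarrow> Re z \<ge> 0 \<Longrightarrow> norm (exp_integral s z) \<le> B"
proof -
  define N where "N = nat \<lceil>2 + R\<rceil>"
  obtain B where B: "\<forall>s z. norm s \<le> R \<and> Re s \<ge> 2 - real N \<and> norm z \<ge> 1 \<and> Re z \<ge> 0 \<longrightarrow> norm (exp_integral s z) \<le> B"
    using exp_integral_bound_halfplane by blast
  have "Re s \<ge> 2 - real N" if "norm s \<le> R" for s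
  proof -
    have "\<bar>Re s\<bar> \<le> R" using that abs_Re_le_cmod[of s] by linarith
    moreover have "2 + R \<le> real N" unfolding N_def by linarith
    ultimately show ?thesis by linarith
  qed
  then show ?thesis using B that by blast
qed

lemma exp_integral_series:
  assumes w: "summable (\<lambda>k. norm (w k))"
    and z: "\<And>k. norm (z k) \<ge> 1" "\<And>k. Re (z k) \<ge> 0"
  shows "summable (\<lambda>k. w k * exp_integral s (z k))"
    and "(\<lambda>s. \<Sum>k. w k * exp_integral s (z k)) holomorphic_on UNIV"
proof -
  have z0: "z k \<noteq> 0" for k using z(1)[of k] by auto
  show "summable (\<lambda>k. w k * exp_integral s (z k))"
  proof -
    obtain B where B: "\<And>s' z. norm s' \<le> norm s \<Longrightarrow> norm z \<ge> 1 \<Longrightarrow> Re z \<ge> 0 \<Longrightarrow> norm (exp_integral s' z) \<le> B"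
      using exp_integral_bound by blast
    show ?thesis
    proof (rule summable_comparison_test')
      show "summable (\<lambda>k. norm (w k) * B)" using w by (rule summable_mult2)
      show "norm (w k * exp_integral s (z k)) \<le> norm (w k) * B" for k
        using B[of s "z k"] z by (auto simp: norm_mult intro!: mult_left_mono)
    qed
  qed
  show "(\<lambda>s. \<Sum>k. w k * exp_integral s (z k)) holomorphic_on UNIV"
  proof (rule holomorphic_uniform_sequence[where f = "\<lambda>n s. \<Sum>k<n. w k * exp_integral s (z k)"])
    show "(\<lambda>s. \<Sum>k<n. w k * exp_integral s (z k)) holomorphic_on UNIV" for n
      using z z0 by (intro holomorphic_intros exp_integral_holomorphic) auto
    fix s0 :: complex
    obtain B where B: "\<And>s' z. norm s' \<le> norm s0 + 1 \<Longrightarrow> norm z \<ge> 1 \<Longrightarrow> Re z \<ge> 0 \<Longrightarrow> norm (exp_integral s' z) \<le> B"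
      using exp_integral_bound by blast
    have "uniform_limit (cball s0 1) (\<lambda>n s. \<Sum>k<n. w k * exp_integral s (z k)) (\<lambda>s. \<Sum>k. w k * exp_integral s (z k)) sequentially"
    proof (rule Weierstrass_m_test)
      show "summable (\<lambda>k. norm (w k) * B)" using w by (rule summable_mult2)
      fix k s assume "s \<in> cball s0 1"
      then have "norm s \<le> norm s0 + 1"
        using norm_triangle_ineq2[of s s0] by (simp add: dist_norm norm_minus_commute)
      then show "norm (w k * exp_integral s (z k)) \<le> norm (w k) * B"
        using B[of s "z k"] z by (auto simp: norm_mult intro!: mult_left_mono)
    qed
    then show "\<exists>d>0. cball s0 d \<subseteq> UNIV \<and> uniform_limit (cball s0 d)
       (\<lambda>n s. \<Sum>k<n. w k * exp_integral s (z k)) (\<lambda>s. \<Sum>k. w k * exp_integral s (z k)) sequentially"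
      by (intro exI[of _ 1]) auto
  qed auto
qed

section \<open>Analytic continuation of the zeta function\<close>

text \<open>
  One step of Euler-Maclaurin summation for \<open>v powr - s\<close>. The antiderivative is what two
  integrations by parts against the Bernoulli polynomials of degree 2 and 1 produce. On the
  closed interval \<open>frac v\<close> may be replaced by \<open>v - m\<close> even at the right end point, because
  \<open>x\<^sup>2 - x + 1/6\<close> takes the same value at \<open>0\<close> and \<open>1\<close>.
\<close>
lemma integral_periodic_bernoulli_unit_step:
  fixes s :: complex
  assumes s: "s \<noteq> 1" and m: "m \<ge> (1::real)" "m \<in> \<int>"
  shows "((\<lambda>v. s * (s + 1) * (of_real v powr (- (s + 2)) * of_real (((frac v)\<^sup>2 - frac v + 1 / 6) / 2))) has_integral
     (- s / 12 * (of_real (m + 1) powr (- s - 1) - of_real m powr (- s - 1))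
      - (of_real (m + 1) powr (- s) + of_real m powr (- s)) / 2
      + (of_real (m + 1) powr (1 - s) - of_real m powr (1 - s)) / (1 - s))) {m..m+1}"
proof -
  define A where "A = (\<lambda>w::complex. - s / 2 * ((w - of_real m)\<^sup>2 - (w - of_real m) + 1 / 6) * w powr (- s - 1)
     - (w - of_real m - 1 / 2) * w powr (- s) + w powr (1 - s) / (1 - s))"
  have "((\<lambda>v. s * (s + 1) * (of_real v powr (- (s + 2)) * of_real (((frac v)\<^sup>2 - frac v + 1 / 6) / 2))) has_integral
     (A (of_real (m + 1)) - A (of_real m))) {m..m+1}"
  proof (rule fundamental_theorem_of_calculus)
    fix v assume v: "v \<in> {m..m+1}"
    have frac: "(frac v)\<^sup>2 - frac v + 1 / 6 = (v - m)\<^sup>2 - (v - m) + 1 / 6"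
    proof (cases "v = m + 1")
      case True
      then show ?thesis using m by (simp add: frac_eq_0_iff[THEN iffD2])
    next
      case False
      then have "frac v = v - m"
        using v m by (intro frac_unique_iff[THEN iffD2]) auto
      then show ?thesis by simp
    qed
    have e: "- (s + 2) = - s - 1 - 1" "1 - s - 1 = - s" by simp_all
    have nz: "1 - s \<noteq> 0" using s by simp
    have v0: "complex_of_real v \<notin> \<real>\<^sub>\<le>\<^sub>0" using v m by (simp add: complex_nonpos_Reals_iff)
    have d: "((\<lambda>w. w powr a) has_field_derivative a * of_real v powr (a - 1)) (at (complex_of_real v))" for a
      using v0 by (rule has_field_derivative_powr)
    have q: "((\<lambda>w. - s / 2 * ((w - of_real m)\<^sup>2 - (w - of_real m) + 1 / 6)) has_field_derivative
        - s / 2 * (2 * (of_real v - of_real m) - 1)) (at (complex_of_real v))"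
      by (auto intro!: derivative_eq_intros)
    have l: "((\<lambda>w. w - of_real m - 1 / 2) has_field_derivative 1) (at (complex_of_real v))"
      by (auto intro!: derivative_eq_intros)
    have alg: "- s / 2 * (2 * x - 1) * b + (- s - 1) * a * (- s / 2 * (x\<^sup>2 - x + 1 / 6))
        - (1 * c + - s * b * (x - 1 / 2)) + (1 - s) * c / (1 - s) = s * (s + 1) * (a * ((x\<^sup>2 - x + 1 / 6) / 2))"
      for a b c x :: complex
      using nz by (simp add: field_simps power2_eq_square)
    have "(A has_field_derivative
        (- s / 2 * (2 * (of_real v - of_real m) - 1) * of_real v powr (- s - 1)
        + (- s - 1) * of_real v powr (- s - 1 - 1) * (- s / 2 * ((of_real v - of_real m)\<^sup>2 - (of_real v - of_real m) + 1 / 6)))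
        - (1 * of_real v powr (- s) + - s * of_real v powr (- s - 1) * (of_real v - of_real m - 1 / 2))
        + (1 - s) * of_real v powr (1 - s - 1) / (1 - s)) (at (complex_of_real v))"
      unfolding A_def by (intro DERIV_add DERIV_diff DERIV_mult DERIV_cdivide q l d)
    also have "(- s / 2 * (2 * (of_real v - of_real m) - 1) * of_real v powr (- s - 1)
        + (- s - 1) * of_real v powr (- s - 1 - 1) * (- s / 2 * ((of_real v - of_real m)\<^sup>2 - (of_real v - of_real m) + 1 / 6)))
        - (1 * of_real v powr (- s) + - s * of_real v powr (- s - 1) * (of_real v - of_real m - 1 / 2))
        + (1 - s) * of_real v powr (1 - s - 1) / (1 - s)
        = s * (s + 1) * (of_real v powr (- (s + 2)) * of_real (((frac v)\<^sup>2 - frac v + 1 / 6) / 2))"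
      unfolding e alg frac by simp
    finally have "(A has_field_derivative s * (s + 1) * (of_real v powr (- (s + 2)) * of_real (((frac v)\<^sup>2 - frac v + 1 / 6) / 2))) (at (of_real v))" .
    then show "((\<lambda>v. A (of_real v)) has_vector_derivative
        s * (s + 1) * (of_real v powr (- (s + 2)) * of_real (((frac v)\<^sup>2 - frac v + 1 / 6) / 2))) (at v within {m..m+1})"
      by (rule has_vector_derivative_real_field)
  qed (use m in auto)
  also have "A (of_real (m + 1)) - A (of_real m) = - s / 12 * (of_real (m + 1) powr (- s - 1) - of_real m powr (- s - 1))
      - (of_real (m + 1) powr (- s) + of_real m powr (- s)) / 2
      + (of_real (m + 1) powr (1 - s) - of_real m powr (1 - s)) / (1 - s)"
    by (simp add: A_def algebra_simps diff_divide_distrib add_divide_distrib)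
  finally show ?thesis .
qed

lemma integral_periodic_bernoulli:
  fixes s :: complex
  assumes s: "s \<noteq> 1"
  shows "((\<lambda>v. s * (s + 1) * (of_real v powr (- (s + 2)) * of_real (((frac v)\<^sup>2 - frac v + 1 / 6) / 2))) has_integral
     (s / 12 + 1 / 2 + 1 / (s - 1) - (\<Sum>k<n. of_nat (Suc k) powr (- s))
      - s / 12 * of_nat (Suc n) powr (- s - 1) - of_nat (Suc n) powr (- s) / 2
      + of_nat (Suc n) powr (1 - s) / (1 - s))) {1..real n + 1}"
proof (induction n)
  case 0
  have "1 / (s - 1) + 1 / (1 - s) = 0"
    using s by (simp add: divide_simps)
  then have "s / 12 + 1 / 2 + 1 / (s - 1) - s / 12 - 1 / 2 + 1 / (1 - s) = 0"
    by (simp add: algebra_simps)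
  then show ?case by (simp add: has_integral_refl)
next
  case (Suc n)
  have step: "((\<lambda>v. s * (s + 1) * (of_real v powr (- (s + 2)) * of_real (((frac v)\<^sup>2 - frac v + 1 / 6) / 2))) has_integral
     (s / 12 + 1 / 2 + 1 / (s - 1) - (\<Sum>k<n. of_nat (Suc k) powr (- s))
      - s / 12 * of_nat (Suc n) powr (- s - 1) - of_nat (Suc n) powr (- s) / 2
      + of_nat (Suc n) powr (1 - s) / (1 - s))
     + (- s / 12 * (of_real (real n + 1 + 1) powr (- s - 1) - of_real (real n + 1) powr (- s - 1))
      - (of_real (real n + 1 + 1) powr (- s) + of_real (real n + 1) powr (- s)) / 2
      + (of_real (real n + 1 + 1) powr (1 - s) - of_real (real n + 1) powr (1 - s)) / (1 - s))) {1..real n + 1 + 1}"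
    by (rule has_integral_combine[OF _ _ Suc.IH integral_periodic_bernoulli_unit_step[OF s]]) auto
  have e: "complex_of_real (real n + 1) = of_nat (Suc n)" "complex_of_real (real n + 1 + 1) = of_nat (Suc (Suc n))"
    and iv: "{1..real n + 1 + 1} = {1..real (Suc n) + 1}" by simp_all
  have alg: "A - (\<Sum>k<Suc n. f k) - s / 12 * a' - f (Suc n) / 2 + c' / (1 - s)
     = A - (\<Sum>k<n. f k) - s / 12 * a - f n / 2 + c / (1 - s)
       + (- s / 12 * (a' - a) - (f (Suc n) + f n) / 2 + (c' - c) / (1 - s))" for A a a' c c' :: complex and f
    by (simp add: algebra_simps add_divide_distrib diff_divide_distrib)
  show ?case
    by (rule has_integral_eq_rhs[OF step[unfolded e iv] alg])
qed

lemma complex_powr_tendsto_0: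
  fixes a :: complex
  assumes "Re a < 0"
  shows "(\<lambda>n. of_nat (Suc n) powr a) \<longlonglongrightarrow> 0"
proof (rule tendsto_norm_zero_cancel)
  have "norm (of_nat (Suc n) powr a) = (real n + 1) powr Re a" for n
    using norm_powr_real_powr[of "of_nat (Suc n)" a] by (simp add: add.commute)
  moreover have "(\<lambda>n. (real n + 1) powr Re a) \<longlonglongrightarrow> 0" using assms by real_asymp
  ultimately show "(\<lambda>n. norm (of_nat (Suc n) powr a)) \<longlonglongrightarrow> 0" by simp
qed

definition zeta_period :: "nat \<Rightarrow> complex" where
  "zeta_period k = \<i> * of_real (2 * pi * real (Suc k))"

lemma norm_zeta_period: "norm (zeta_period k) \<ge> 1" "Re (zeta_period k) = 0" "zeta_period k \<noteq> 0"
proof -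
  have "1 * 1 \<le> (2 * pi) * real (Suc k)"
    using pi_gt3 by (intro mult_mono) auto
  then show "norm (zeta_period k) \<ge> 1" by (simp add: zeta_period_def norm_mult del: of_nat_Suc)
qed (simp_all add: zeta_period_def del: of_nat_Suc)

lemma sum_of_conjugate_kernels:
  "expint_kernel (- (\<i> * of_real c)) t v + expint_kernel (\<i> * of_real c) t v
     = of_real v powr (- t) * of_real (2 * cos (c * v))"
proof -
  have "exp (\<i> * of_real (c * v)) + exp (- (\<i> * of_real (c * v))) = 2 * cos (of_real (c * v) :: complex)"
    by (simp add: cos_exp_eq)
  also have "\<dots> = of_real (2 * cos (c * v))" unfolding cos_of_real by simp
  finally show ?thesis
    by (simp add: expint_kernel_def mult_ac flip: distrib_left)
qed

lemma norm_sum_of_conjugate_kernels: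
  assumes "v > 0"
  shows "norm (of_real v powr (- t) * complex_of_real (2 * cos x)) \<le> 2 * v powr (- Re t)"
proof -
  have "v powr (- Re t) * (2 * \<bar>cos x\<bar>) \<le> v powr (- Re t) * 2"
    by (intro mult_left_mono) auto
  then show ?thesis using assms by (simp add: norm_mult norm_powr_real_powr abs_mult)
qed

text \<open>
  The factor for which \<open>2 cos (2 \<pi> (k + 1) v)\<close> sums to half of the periodic Bernoulli
  polynomial of degree 2.
\<close>
definition zeta_weight :: "nat \<Rightarrow> complex" where
  "zeta_weight k = of_real (1 / (4 * pi\<^sup>2) * (1 / (real k + 1)\<^sup>2))"

lemma summable_zeta_weight: "summable (\<lambda>k. norm (zeta_weight k))"
proof -
  have "norm (zeta_weight k) = 1 / (4 * pi\<^sup>2) * (1 / (real k + 1)\<^sup>2)" for k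
    unfolding zeta_weight_def norm_of_real by simp
  then show ?thesis
    using summable_mult[OF summable_inverse_squares, of "1 / (4 * pi\<^sup>2)"] by simp
qed

lemma euler_maclaurin_remainder_sums:
  assumes s: "Re s > 1"
  defines "P \<equiv> \<lambda>v. of_real v powr (- (s + 2)) * of_real (((frac v)\<^sup>2 - frac v + 1 / 6) / 2)"
  shows "(\<lambda>k. zeta_weight k * exp_integral (s + 2) (- zeta_period k)
            + zeta_weight k * exp_integral (s + 2) (zeta_period k)) sums integral {1..} P"
    and "P absolutely_integrable_on {1..}"
proof -
  have int: "((\<lambda>v. zeta_weight k * (of_real v powr (- (s + 2)) * of_real (2 * cos (2 * pi * real (Suc k) * v)))) has_integral
      (zeta_weight k * exp_integral (s + 2) (- zeta_period k) + zeta_weight k * exp_integral (s + 2) (zeta_period k))) {1..}" for k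
  proof -
    have "((\<lambda>v. zeta_weight k * (expint_kernel (- zeta_period k) (s + 2) v + expint_kernel (zeta_period k) (s + 2) v)) has_integral
       (zeta_weight k * (exp_integral (s + 2) (- zeta_period k) + exp_integral (s + 2) (zeta_period k)))) {1..}"
      using s norm_zeta_period[of k]
      by (intro has_integral_mult_right has_integral_add exp_integral_has_integral) auto
    then show ?thesis
      unfolding zeta_period_def sum_of_conjugate_kernels distrib_left .
  qed
  have h: "(\<lambda>v. 2 * v powr (- Re (s + 2))) integrable_on {1..}"
    using has_integral_powr_to_inf[of "- Re (s + 2)" 1] s by (auto intro!: integrable_on_mult_right)
  have le: "norm (zeta_weight k * (of_real v powr (- (s + 2)) * of_real (2 * cos (2 * pi * real (Suc k) * v))))
      \<le> norm (zeta_weight k) * (2 * v powr (- Re (s + 2)))" if "v \<in> {1..}" for k v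
    unfolding norm_mult[of "zeta_weight k"]
    using that by (intro mult_left_mono norm_sum_of_conjugate_kernels) auto
  have sums: "(\<lambda>k. zeta_weight k * (of_real v powr (- (s + 2)) * of_real (2 * cos (2 * pi * real (Suc k) * v)))) sums P v"
    if "v \<in> {1..}" for v
  proof -
    have "(\<lambda>k. of_real (cos (2 * pi * real (Suc k) * v) / (real (Suc k))\<^sup>2)) sums
        complex_of_real (pi\<^sup>2 * ((frac v)\<^sup>2 - frac v + 1 / 6))"
      by (intro sums_of_real fourier_periodic_bernoulli_2)
    from sums_mult[OF this, of "of_real v powr (- (s + 2)) * of_real (1 / (2 * pi\<^sup>2))"]
    have "(\<lambda>k. of_real v powr (- (s + 2)) * of_real (1 / (2 * pi\<^sup>2) * (cos (2 * pi * real (Suc k) * v) / (real (Suc k))\<^sup>2)))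
       sums (of_real v powr (- (s + 2)) * of_real (1 / (2 * pi\<^sup>2) * (pi\<^sup>2 * ((frac v)\<^sup>2 - frac v + 1 / 6))))"
      by (simp only: of_real_mult mult.assoc)
    moreover have "1 / (2 * pi\<^sup>2) * (pi\<^sup>2 * ((frac v)\<^sup>2 - frac v + 1 / 6)) = ((frac v)\<^sup>2 - frac v + 1 / 6) / 2"
      by simp
    moreover have "of_real v powr (- (s + 2)) * of_real (1 / (2 * pi\<^sup>2) * (cos (2 * pi * real (Suc k) * v) / (real (Suc k))\<^sup>2))
       = zeta_weight k * (of_real v powr (- (s + 2)) * of_real (2 * cos (2 * pi * real (Suc k) * v)))" for k
    proof -
      have "1 / (2 * pi\<^sup>2) * (cos (2 * pi * real (Suc k) * v) / (real (Suc k))\<^sup>2)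
          = 1 / (4 * pi\<^sup>2) * (1 / (real k + 1)\<^sup>2) * (2 * cos (2 * pi * real (Suc k) * v))"
        by (simp add: add.commute)
      then show ?thesis
        unfolding zeta_weight_def by (simp only: of_real_mult mult_ac)
    qed
    ultimately show ?thesis by (simp only: P_def)
  qed
  show "(\<lambda>k. zeta_weight k * exp_integral (s + 2) (- zeta_period k)
            + zeta_weight k * exp_integral (s + 2) (zeta_period k)) sums integral {1..} P"
    by (rule sums_has_integral_dominated[OF int h _ summable_zeta_weight _ le sums]) auto
  have P: "P integrable_on {1..}"
    by (rule sums_has_integral_dominated[OF int h _ summable_zeta_weight _ le sums]) auto
  show "P absolutely_integrable_on {1..}"
  proof (rule absolutely_integrable_integrable_bound[OF _ P h])
    fix v :: real assume v: "v \<in> {1..}"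
    have "\<bar>(frac v)\<^sup>2 - frac v + 1 / 6\<bar> \<le> 4"
    proof -
      have "(frac v)\<^sup>2 \<le> 1"
        using frac_ge_0[of v] frac_lt_1[of v] by (intro power_le_one) auto
      then show ?thesis
        using frac_ge_0[of v] frac_lt_1[of v] zero_le_power2[of "frac v"] by linarith
    qed
    then have "v powr (- Re (s + 2)) * (\<bar>(frac v)\<^sup>2 - frac v + 1 / 6\<bar> / 2) \<le> v powr (- Re (s + 2)) * 2"
      by (intro mult_left_mono) auto
    then show "norm (P v) \<le> 2 * v powr (- Re (s + 2))"
      using v unfolding P_def norm_mult norm_of_real abs_divide
      by (simp add: norm_powr_real_powr mult.commute)
  qed
qed

text \<open>
  Only the remainder integral fails to be an explicit meromorphic function of \<open>s\<close>, and its
  expansion into exponential integrals continues it to all of the plane.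
\<close>
lemma zeta_dirichlet_sums_euler_maclaurin:
  assumes s: "Re s > 1"
  shows "(\<lambda>n. of_nat (Suc n) powr (- s)) sums
    (1 / 2 + 1 / (s - 1) + s / 12 - s * (s + 1) *
      (\<Sum>k. zeta_weight k * exp_integral (s + 2) (- zeta_period k) + zeta_weight k * exp_integral (s + 2) (zeta_period k)))"
proof -
  define P where "P = (\<lambda>v. of_real v powr (- (s + 2)) * complex_of_real (((frac v)\<^sup>2 - frac v + 1 / 6) / 2))"
  have s1: "s \<noteq> 1" using s by auto
  define J where "J = (\<lambda>n. integral {1..real n + 1} (\<lambda>v. s * (s + 1) * P v))"
  have J: "((\<lambda>v. s * (s + 1) * P v) has_integral
     (s / 12 + 1 / 2 + 1 / (s - 1) - (\<Sum>k<n. of_nat (Suc k) powr (- s))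
      - s / 12 * of_nat (Suc n) powr (- s - 1) - of_nat (Suc n) powr (- s) / 2
      + of_nat (Suc n) powr (1 - s) / (1 - s))) {1..real n + 1}" for n
    unfolding P_def by (rule integral_periodic_bernoulli[OF s1])
  have "J \<longlonglongrightarrow> integral {1..} (\<lambda>v. s * (s + 1) * P v)"
    unfolding J_def
  proof (rule integral_exhausting_limit)
    show "(\<lambda>v. s * (s + 1) * P v) absolutely_integrable_on {1..}"
      using euler_maclaurin_remainder_sums(2)[OF s] unfolding P_def
      by (rule set_integrable_mult_right)
    show "(\<lambda>v. s * (s + 1) * P v) integrable_on {1..real n + 1}" for n using J by blast
    show "\<forall>\<^sub>F n in sequentially. v \<in> {1..real n + 1}" if "v \<in> {1..}" for v
    proof -
      have "\<forall>\<^sub>F n in sequentially. v \<le> real n"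
        using eventually_ge_at_top[of "nat \<lceil>v\<rceil>"] by eventually_elim linarith
      then show ?thesis by eventually_elim (use that in auto)
    qed
  qed auto
  also have "integral {1..} (\<lambda>v. s * (s + 1) * P v) = s * (s + 1) * (\<Sum>k. zeta_weight k * exp_integral (s + 2) (- zeta_period k) + zeta_weight k * exp_integral (s + 2) (zeta_period k))"
    using euler_maclaurin_remainder_sums(1)[OF s] unfolding P_def by (simp add: sums_iff)
  finally have lim: "J \<longlonglongrightarrow> \<dots>" .
  have "(\<lambda>n. s / 12 + 1 / 2 + 1 / (s - 1) - J n
      - s / 12 * of_nat (Suc n) powr (- s - 1) - of_nat (Suc n) powr (- s) / 2
      + of_nat (Suc n) powr (1 - s) / (1 - s)) \<longlonglongrightarrow> s / 12 + 1 / 2 + 1 / (s - 1) - 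
      s * (s + 1) * (\<Sum>k. zeta_weight k * exp_integral (s + 2) (- zeta_period k) + zeta_weight k * exp_integral (s + 2) (zeta_period k))
      - s / 12 * 0 - 0 / 2 + 0 / (1 - s)"
    using s s1 by (intro tendsto_intros lim complex_powr_tendsto_0) auto
  moreover have "s / 12 + 1 / 2 + 1 / (s - 1) - J n
      - s / 12 * of_nat (Suc n) powr (- s - 1) - of_nat (Suc n) powr (- s) / 2
      + of_nat (Suc n) powr (1 - s) / (1 - s) = (\<Sum>k<n. of_nat (Suc k) powr (- s))" for n
  proof -
    have "J n = s / 12 + 1 / 2 + 1 / (s - 1) - (\<Sum>k<n. of_nat (Suc k) powr (- s))
      - s / 12 * of_nat (Suc n) powr (- s - 1) - of_nat (Suc n) powr (- s) / 2
      + of_nat (Suc n) powr (1 - s) / (1 - s)"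
      unfolding J_def by (rule integral_unique[OF J])
    then show ?thesis by simp
  qed
  ultimately show ?thesis by (simp add: sums_def algebra_simps)
qed

lemma riemann_zeta_holomorphic: "riemann_zeta holomorphic_on (- {1})"
  and riemann_zeta_sums: "\<And>s. Re s > 1 \<Longrightarrow> (\<lambda>n. of_nat (Suc n) powr (- s)) sums riemann_zeta s"
proof -
  define f where "f = (\<lambda>s. 1 / 2 + 1 / (s - 1) + s / 12 - s * (s + 1) *
      ((\<Sum>k. zeta_weight k * exp_integral (s + 2) (- zeta_period k)) + (\<Sum>k. zeta_weight k * exp_integral (s + 2) (zeta_period k))))"
  note ser1 = exp_integral_series[where z = "\<lambda>k. - zeta_period k", OF summable_zeta_weight]
  note ser2 = exp_integral_series[where z = "\<lambda>k. zeta_period k", OF summable_zeta_weight]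
  have h: "(\<lambda>s. g (s + 2)) holomorphic_on - {1}" if "g holomorphic_on UNIV" for g :: "complex \<Rightarrow> complex"
  proof -
    have "(\<lambda>s::complex. s + 2) holomorphic_on - {1}" by (intro holomorphic_intros)
    from holomorphic_on_compose_gen[OF this that] show ?thesis by (simp add: o_def)
  qed
  have f: "f holomorphic_on - {1}"
    unfolding f_def
    by (intro holomorphic_intros h[OF ser1(2)] h[OF ser2(2)]) (auto simp: norm_zeta_period)
  have sums: "(\<lambda>n. of_nat (Suc n) powr (- s)) sums f s" if "Re s > 1" for s
    using zeta_dirichlet_sums_euler_maclaurin[OF that] unfolding f_def
    by (subst suminf_add[OF ser1(1) ser2(1)]) (auto simp: norm_zeta_period)
  have eq: "riemann_zeta s = f s" if "s \<noteq> 1" for s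
    using f sums that by (rule riemann_zeta_eqI)
  show "riemann_zeta holomorphic_on (- {1})"
    using f by (rule holomorphic_transform) (simp add: eq)
  show "(\<lambda>n. of_nat (Suc n) powr (- s)) sums riemann_zeta s" if "Re s > 1" for s
    using sums[OF that] eq[of s] that by (metis less_irrefl one_complex.sel(1))
qed

text \<open>
  The factor \<open>2 powr s - 1\<close> removes the terms at even integers from the Dirichlet series and
  rescales those at odd integers.
\<close>
lemma half_integer_dirichlet_sums:
  assumes s: "Re s > 1"
  shows "(\<lambda>k. (of_nat k + 1 / 2) powr (- s)) sums ((2 powr s - 1) * riemann_zeta s)"
proof -
  define b where "b = (\<lambda>n. complex_of_nat (Suc n) powr (- s))"
  have b: "b sums riemann_zeta s" unfolding b_def by (rule riemann_zeta_sums[OF s])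
  have "(\<lambda>n. sum b {n * 2..<n * 2 + 2}) sums riemann_zeta s"
    using b by (rule sums_group) simp
  moreover have "sum b {n * 2..<n * 2 + 2} = b (2 * n) + b (2 * n + 1)" for n
    by (simp add: numeral_2_eq_2 mult.commute)
  ultimately have 1: "(\<lambda>n. b (2 * n) + b (2 * n + 1)) sums riemann_zeta s" by simp
  have "b (2 * n + 1) = 2 powr (- s) * b n" for n
  proof -
    have "complex_of_nat (Suc (2 * n + 1)) = 2 * of_nat (Suc n)" by simp
    then show ?thesis unfolding b_def by (simp only:) (rule powr_times_real; simp)
  qed
  then have "(\<lambda>n. b (2 * n + 1)) sums (2 powr (- s) * riemann_zeta s)"
    using sums_mult[OF b, of "2 powr (- s)"] by simp
  from sums_mult[OF sums_diff[OF 1 this], of "2 powr s"]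
  have "(\<lambda>n. 2 powr s * b (2 * n)) sums (2 powr s * (riemann_zeta s - 2 powr (- s) * riemann_zeta s))"
    by simp
  moreover have "2 powr s * b (2 * n) = (of_nat n + 1 / 2) powr (- s)" for n
  proof -
    have e: "complex_of_nat (Suc (2 * n)) = 2 * of_real (real n + 1 / 2)" by simp
    have "b (2 * n) = 2 powr (- s) * of_real (real n + 1 / 2) powr (- s)"
      unfolding b_def e by (rule powr_times_real) (auto simp: Reals_of_real)
    then show ?thesis by (simp add: powr_minus field_simps)
  qed
  ultimately show ?thesis by (simp add: powr_minus algebra_simps)
qed

section \<open>The incomplete Gamma integral on the imaginary axis\<close>

lemma norm_powr_le:
  fixes w c :: complex
  assumes w: "w \<noteq> 0" and r: "0 < r" "r \<le> norm w" and c: "Re c \<le> 0"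
  shows "norm (w powr c) \<le> r powr Re c * exp (\<bar>Im c\<bar> * pi)"
proof -
  have "norm (w powr c) = exp (Re c * ln (norm w)) * exp (- (Im c * Im (Ln w)))"
    using w by (simp add: powr_def Re_Ln exp_diff exp_minus field_simps flip: exp_add)
  also have "\<dots> \<le> exp (Re c * ln r) * exp (\<bar>Im c\<bar> * pi)"
  proof (intro mult_mono)
    show "exp (Re c * ln (norm w)) \<le> exp (Re c * ln r)"
    proof -
      have "ln r \<le> ln (norm w)" using r by (subst ln_le_cancel_iff) auto
      then show ?thesis using c by (simp add: mult_left_mono_neg)
    qed
    have "- (Im c * Im (Ln w)) \<le> \<bar>Im c\<bar> * \<bar>Im (Ln w)\<bar>"
      by (metis abs_ge_minus_self abs_mult)
    also have "\<dots> \<le> \<bar>Im c\<bar> * pi"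
      using Im_Ln_le_pi[OF w] mpi_less_Im_Ln[OF w] by (intro mult_left_mono) auto
    finally show "exp (- (Im c * Im (Ln w))) \<le> exp (\<bar>Im c\<bar> * pi)" by simp
  qed auto
  finally show ?thesis using r by (simp add: powr_def)
qed

text \<open>
  Here \<open>g\<close> is a primitive of the integrand of the Gamma integral. Its increment between the
  points \<open>\<rho>\<close> and \<open>\<plusminus> \<i> \<rho>\<close> is estimated along the segment joining them, on which the
  modulus is at least \<open>\<rho> / 2\<close>; for \<open>0 < Re a < 1\<close> the bound tends to \<open>0\<close> both as \<open>\<rho>\<close>
  tends to \<open>0\<close> and as it tends to infinity.
\<close>
lemma gamma_primitive_rotation_bound:
  fixes a u :: complex and g :: "complex \<Rightarrow> complex"
  assumes a: "0 < Re a" "Re a < 1" and u: "u = \<i> \<or> u = - \<i>" and r: "\<rho> > 0"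
    and g: "\<And>w. w \<notin> \<real>\<^sub>\<le>\<^sub>0 \<Longrightarrow> (g has_field_derivative w powr (a - 1) * exp (- w)) (at w)"
  shows "norm (g (u * of_real \<rho>) - g (of_real \<rho>))
     \<le> 2 * exp (\<bar>Im a\<bar> * pi) * 2 powr (1 - Re a) * (\<rho> powr (Re a - 1) * (1 - exp (- \<rho>)))"
proof -
  define p where "p = (\<lambda>t::real. of_real \<rho> * (of_real (1 - t) + u * of_real t))"
  define C where "C = 2 * exp (\<bar>Im a\<bar> * pi) * 2 powr (1 - Re a) * \<rho> powr (Re a - 1)"
  have Rep: "Re (p t) = \<rho> * (1 - t)" for t using u by (auto simp: p_def)
  have Imp: "\<bar>Im (p t)\<bar> = \<rho> * \<bar>t\<bar>" for t using u r by (auto simp: p_def abs_mult)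
  have pnn: "p t \<notin> \<real>\<^sub>\<le>\<^sub>0" if "t \<in> {0..1}" for t
    using Rep[of t] Imp[of t] that r
    by (auto simp: complex_nonpos_Reals_iff mult_le_0_iff)
  have norm_p: "norm (p t) \<ge> \<rho> / 2" if t: "t \<in> {0..1}" for t
  proof (cases "t \<le> 1 / 2")
    case True
    have "\<rho> * (1 / 2) \<le> \<rho> * (1 - t)" using True r by (intro mult_left_mono) auto
    also have "\<dots> \<le> norm (p t)" using abs_Re_le_cmod[of "p t"] Rep[of t] by linarith
    finally show ?thesis by simp
  next
    case False
    have "\<rho> * (1 / 2) \<le> \<rho> * \<bar>t\<bar>" using False r by (intro mult_left_mono) auto
    also have "\<dots> \<le> norm (p t)" using abs_Im_le_cmod[of "p t"] Imp[of t] by linarith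
    finally show ?thesis by simp
  qed
  have int: "((\<lambda>t. of_real \<rho> * (u - 1) * (p t powr (a - 1) * exp (- p t))) has_integral
      (g (p 1) - g (p 0))) {0..1}"
  proof -
    have "((g \<circ> p) has_vector_derivative of_real \<rho> * (u - 1) * (p t powr (a - 1) * exp (- p t))) (at t within {0..1})"
      if t: "t \<in> {0..1}" for t
    proof -
      have "(p has_vector_derivative of_real \<rho> * (u - 1)) (at t)"
        unfolding p_def by (auto intro!: derivative_eq_intros simp: algebra_simps)
      from field_vector_diff_chain_at[OF this g[OF pnn[OF t]]]
      show ?thesis by (rule has_vector_derivative_at_within)
    qed
    then have "((\<lambda>t. of_real \<rho> * (u - 1) * (p t powr (a - 1) * exp (- p t))) has_integral
      ((g \<circ> p) 1 - (g \<circ> p) 0)) {0..1}"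
      by (rule fundamental_theorem_of_calculus[OF zero_le_one])
    then show ?thesis by simp
  qed
  have bint: "((\<lambda>t. C * (\<rho> * exp (- \<rho> * (1 - t)))) has_integral C * (exp (- \<rho> * (1 - 1)) - exp (- \<rho> * (1 - 0)))) {0..1}"
    by (intro has_integral_mult_right fundamental_theorem_of_calculus)
       (auto intro!: derivative_eq_intros simp flip: has_real_derivative_iff_has_vector_derivative)
  have le: "norm (of_real \<rho> * (u - 1) * (p t powr (a - 1) * exp (- p t))) \<le> C * (\<rho> * exp (- \<rho> * (1 - t)))"
    if t: "t \<in> {0..1}" for t
  proof -
    have "norm (u - 1) \<le> 2" using norm_triangle_ineq4[of u 1] u by auto
    moreover have "norm (p t powr (a - 1)) \<le> (\<rho> / 2) powr (Re a - 1) * exp (\<bar>Im a\<bar> * pi)"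
    proof -
      have "p t \<noteq> 0" using norm_p[OF t] r by auto
      then show ?thesis
        using norm_powr_le[of "p t" "\<rho> / 2" "a - 1"] norm_p[OF t] r a by simp
    qed
    ultimately have "norm (u - 1) * norm (p t powr (a - 1)) \<le> 2 * ((\<rho> / 2) powr (Re a - 1) * exp (\<bar>Im a\<bar> * pi))"
      by (intro mult_mono) auto
    also have "(\<rho> / 2) powr (Re a - 1) = \<rho> powr (Re a - 1) * 2 powr (1 - Re a)"
      using r powr_minus[of 2 "Re a - 1"] by (simp add: powr_divide field_simps)
    also have "2 * (\<rho> powr (Re a - 1) * 2 powr (1 - Re a) * exp (\<bar>Im a\<bar> * pi)) = C"
      by (simp add: C_def mult_ac)
    finally have "norm (u - 1) * norm (p t powr (a - 1)) * (\<rho> * exp (- \<rho> * (1 - t))) \<le> C * (\<rho> * exp (- \<rho> * (1 - t)))"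
      using r by (intro mult_right_mono) auto
    then show ?thesis using r Rep[of t] by (simp add: norm_mult mult_ac)
  qed
  have "norm (g (p 1) - g (p 0)) \<le> C * (exp (- \<rho> * (1 - 1)) - exp (- \<rho> * (1 - 0)))"
    using integral_norm_bound_integral[OF has_integral_integrable[OF int] has_integral_integrable[OF bint] le]
    by (simp only: integral_unique[OF int] integral_unique[OF bint])
  then show ?thesis by (simp add: p_def C_def mult_ac)
qed

lemma expint_kernel_absolutely_integrable_unit:
  assumes a: "0 < Re a" and z: "Re z \<ge> 0"
  shows "expint_kernel z (1 - a) absolutely_integrable_on {0<..1}"
proof -
  have int: "(\<lambda>v. v powr (Re a - 1)) integrable_on {0<..1}"
    using a by (intro integrable_on_powr_from_0') auto
  have le: "norm (expint_kernel z (1 - a) v) \<le> v powr (Re a - 1)" if "v \<in> {0<..1}" for v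
    using norm_expint_kernel_le[of v z "1 - a"] that z by simp
  have "expint_kernel z (1 - a) integrable_on {0<..1}"
    by (rule measurable_bounded_by_integrable_imp_integrable[OF _ int le])
       (auto intro!: continuous_imp_measurable_on_sets_lebesgue continuous_on_expint_kernel)
  from absolutely_integrable_integrable_bound[OF _ this int] show ?thesis
    using le by blast
qed

text \<open>
  The Gamma integral may be rotated from the positive real axis to the imaginary axis: the
  increments of a primitive along the two rays differ by the rotation terms at \<open>0\<close> and at
  infinity, both of which vanish in the limit. On the imaginary axis the piece beyond \<open>v = 1\<close>
  is the exponential integral.
\<close>
lemma gamma_integral_rotated:
  fixes a u :: complex and \<kappa> :: real
  assumes a: "0 < Re a" "Re a < 1" and u: "u = \<i> \<or> u = - \<i>" and \<kappa>: "\<kappa> > 0"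
  defines "z \<equiv> u * of_real \<kappa>"
  shows "exp_integral (1 - a) z = z powr (- a) * Gamma a - integral {0<..1} (expint_kernel z (1 - a))"
proof -
  define f where "f = (\<lambda>w. w powr (a - 1) * exp (- w))"
  have z: "Re z \<ge> 0" "z \<noteq> 0" "z \<notin> \<real>\<^sub>\<le>\<^sub>0"
    using u \<kappa> by (auto simp: z_def complex_nonpos_Reals_iff)
  obtain g where g: "\<And>w. w \<notin> \<real>\<^sub>\<le>\<^sub>0 \<Longrightarrow> (g has_field_derivative f w) (at w)"
  proof -
    have eq: "- (complex_of_real ` {..0}) = {w. w \<notin> \<real>\<^sub>\<le>\<^sub>0}"
      by (auto simp: nonpos_Reals_def)
    have "\<exists>g. \<forall>w\<in>- (complex_of_real ` {..0}). (g has_field_derivative f w) (at w)"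
    proof (rule holomorphic_starlike_primitive[where k = "{}"])
      show "open (- (complex_of_real ` {..0}))"
        unfolding eq using closed_nonpos_Reals_complex by (simp add: Collect_neg_eq open_Compl)
      have h: "f holomorphic_on - (complex_of_real ` {..0})"
        unfolding f_def eq by (intro holomorphic_intros) auto
      then show "continuous_on (- (complex_of_real ` {..0})) f"
        by (rule holomorphic_on_imp_continuous_on)
      show "f field_differentiable at x" if "x \<in> - (complex_of_real ` {..0}) - {}" for x
        using h \<open>open _\<close> that by (auto intro: holomorphic_on_imp_differentiable_at)
    qed (auto intro: starlike_slotted_complex_plane_left)
    then show ?thesis using that unfolding eq by blast
  qed
  have ray: "((\<lambda>v. c * f (c * of_real v)) has_integral (g (c * of_real y) - g (c * of_real x))) {x..y}"
    if "0 < x" "x \<le> y" "c = z \<or> c = 1" for c x y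
  proof (rule fundamental_theorem_of_calculus)
    fix v assume v: "v \<in> {x..y}"
    have "c * of_real v \<notin> \<real>\<^sub>\<le>\<^sub>0" using v that u \<kappa> by (auto simp: z_def complex_nonpos_Reals_iff)
    then have "((\<lambda>w. g (c * w)) has_field_derivative f (c * of_real v) * c) (at (of_real v))"
      by (intro DERIV_chain2[OF g DERIV_cmult_Id])
    from has_vector_derivative_real_field[OF this]
    show "((\<lambda>v. g (c * of_real v)) has_vector_derivative c * f (c * of_real v)) (at v within {x..y})"
      by (simp add: mult.commute)
  qed (use that in auto)
  \<comment> \<open>The rays are cut off to \<open>X n \<le> v \<le> Y n\<close>, exhausting \<open>v > 0\<close>.\<close>
  define X where "X = (\<lambda>n::nat. 1 / (real n + 1))"
  define Y where "Y = (\<lambda>n::nat. real n + 1)"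
  have XY: "0 < X n" "X n \<le> 1" "1 \<le> Y n" for n by (auto simp: X_def Y_def)
  have evX: "\<forall>\<^sub>F n in sequentially. c * X n \<le> v" if "v > 0" for c v :: real
  proof -
    have "(\<lambda>n. c * X n) \<longlonglongrightarrow> 0" unfolding X_def by real_asymp
    from order_tendstoD(2)[OF this that] show ?thesis by eventually_elim simp
  qed
  have evY: "\<forall>\<^sub>F n in sequentially. v \<le> c * Y n" if "c > 0" for c v :: real
  proof -
    have "filterlim (\<lambda>n. c * Y n) at_top sequentially" unfolding Y_def using that by real_asymp
    then show ?thesis by (simp add: filterlim_at_top)
  qed
  have Gamma_lim: "(\<lambda>n. g (of_real (\<kappa> * Y n)) - g (of_real (\<kappa> * X n))) \<longlonglongrightarrow> Gamma a"
  proof -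
    have kXY: "0 < \<kappa> * X n" "\<kappa> * X n \<le> \<kappa> * Y n" for n
      using XY[of n] \<kappa> by (auto intro!: mult_pos_pos mult_left_mono)
    define G where "G = (\<lambda>t. complex_of_real t powr (a - 1) / of_real (exp (1 * t)))"
    have Gf: "G v = 1 * f (1 * of_real v)" for v
      by (simp add: G_def f_def exp_minus field_simps flip: exp_of_real)
    have "(\<lambda>n. integral {\<kappa> * X n..\<kappa> * Y n} G) \<longlonglongrightarrow> integral {0<..} G"
    proof (rule integral_exhausting_limit)
      show "G absolutely_integrable_on {0<..}"
        unfolding G_def using a by (intro absolutely_integrable_Gamma_integral) auto
      show "{\<kappa> * X n..\<kappa> * Y n} \<subseteq> {0<..}" for n using kXY[of n] by auto
      show "G integrable_on {\<kappa> * X n..\<kappa> * Y n}" for n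
        unfolding Gf using ray[of "\<kappa> * X n" "\<kappa> * Y n" 1] kXY[of n] by blast
      show "\<forall>\<^sub>F n in sequentially. v \<in> {\<kappa> * X n..\<kappa> * Y n}" if "v \<in> {0<..}" for v
        using evX[of v \<kappa>] evY[of \<kappa> v] that \<kappa> by (auto elim: eventually_elim2)
    qed
    moreover have "integral {0<..} G = Gamma a"
      using Gamma_integral_complex'[of a] a by (simp add: G_def integral_unique)
    moreover have "integral {\<kappa> * X n..\<kappa> * Y n} G = g (of_real (\<kappa> * Y n)) - g (of_real (\<kappa> * X n))" for n
      using ray[of "\<kappa> * X n" "\<kappa> * Y n" 1] kXY[of n] unfolding Gf by (simp add: integral_unique)
    ultimately show ?thesis by simp
  qed
  have rot: "norm (g (u * of_real \<rho>) - g (of_real \<rho>))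
     \<le> 2 * exp (\<bar>Im a\<bar> * pi) * 2 powr (1 - Re a) * (\<rho> powr (Re a - 1) * (1 - exp (- \<rho>)))" if "\<rho> > 0" for \<rho>
    using a u that g unfolding f_def by (intro gamma_primitive_rotation_bound) auto
  have limY: "(\<lambda>n. g (u * of_real (\<kappa> * Y n)) - g (of_real (\<kappa> * Y n))) \<longlonglongrightarrow> 0"
  proof (rule Lim_null_comparison[OF always_eventually[OF allI]])
    show "norm (g (u * of_real (\<kappa> * Y n)) - g (of_real (\<kappa> * Y n))) \<le>
      2 * exp (\<bar>Im a\<bar> * pi) * 2 powr (1 - Re a) * ((\<kappa> * Y n) powr (Re a - 1) * (1 - exp (- (\<kappa> * Y n))))" for n
      using XY[of n] \<kappa> by (intro rot) auto
    show "(\<lambda>n. 2 * exp (\<bar>Im a\<bar> * pi) * 2 powr (1 - Re a) * ((\<kappa> * Y n) powr (Re a - 1) * (1 - exp (- (\<kappa> * Y n))))) \<longlonglongrightarrow> 0"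
      unfolding Y_def using a \<kappa> by (intro tendsto_mult_right_zero) real_asymp
  qed
  have limX: "(\<lambda>n. g (u * of_real (\<kappa> * X n)) - g (of_real (\<kappa> * X n))) \<longlonglongrightarrow> 0"
  proof (rule Lim_null_comparison[OF always_eventually[OF allI]])
    show "norm (g (u * of_real (\<kappa> * X n)) - g (of_real (\<kappa> * X n))) \<le>
      2 * exp (\<bar>Im a\<bar> * pi) * 2 powr (1 - Re a) * ((\<kappa> * X n) powr (Re a - 1) * (1 - exp (- (\<kappa> * X n))))" for n
      using XY[of n] \<kappa> by (intro rot) auto
    show "(\<lambda>n. 2 * exp (\<bar>Im a\<bar> * pi) * 2 powr (1 - Re a) * ((\<kappa> * X n) powr (Re a - 1) * (1 - exp (- (\<kappa> * X n))))) \<longlonglongrightarrow> 0"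
      unfolding X_def using a \<kappa> by (intro tendsto_mult_right_zero) real_asymp
  qed
  have u_\<kappa>: "u * of_real (\<kappa> * x) = z * of_real x" for x by (simp add: z_def)
  have rotated_lim: "(\<lambda>n. g (z * of_real (Y n)) - g (z * of_real (X n))) \<longlonglongrightarrow> Gamma a"
    unfolding u_\<kappa>[symmetric] using tendsto_add[OF Gamma_lim tendsto_diff[OF limY limX]] by simp
  have kernel: "expint_kernel z (1 - a) v = z powr (- a) * (z * f (z * of_real v))" if v: "v > 0" for v
  proof -
    have "(z * of_real v) powr (a - 1) = z powr (a - 1) * of_real v powr (a - 1)"
      using Ln_times_of_real[OF v z(2)] v z(2)
      by (simp add: powr_def mult.commute[of z] Ln_of_real exp_add ring_distribs)
    moreover have "z powr (- a) * (z * z powr (a - 1)) = 1"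
      using z by (simp add: powr_diff powr_minus)
    ultimately show ?thesis
      by (simp add: expint_kernel_def f_def)
  qed
  have kint: "(expint_kernel z (1 - a) has_integral z powr (- a) * (g (z * of_real y) - g (z * of_real x))) {x..y}"
    if "0 < x" "x \<le> y" for x y
    using has_integral_mult_right[OF ray[OF that, of z], of "z powr (- a)"]
    by (rule has_integral_eq[rotated]) (use that kernel in auto)
  have "(\<lambda>n. integral {X n..1} (expint_kernel z (1 - a)) + integral {1..Y n} (expint_kernel z (1 - a)))
     \<longlonglongrightarrow> integral {0<..1} (expint_kernel z (1 - a)) + exp_integral (1 - a) z"
  proof (rule tendsto_add)
    show "(\<lambda>n. integral {X n..1} (expint_kernel z (1 - a))) \<longlonglongrightarrow> integral {0<..1} (expint_kernel z (1 - a))"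
    proof (rule integral_exhausting_limit)
      show "expint_kernel z (1 - a) absolutely_integrable_on {0<..1}"
        using a z by (intro expint_kernel_absolutely_integrable_unit) auto
      show "{X n..1} \<subseteq> {0<..1}" for n using XY[of n] by auto
      show "expint_kernel z (1 - a) integrable_on {X n..1}" for n
        using kint[of "X n" 1] XY[of n] by blast
      show "\<forall>\<^sub>F n in sequentially. v \<in> {X n..1}" if "v \<in> {0<..1}" for v
        using evX[of v 1] that by (auto elim: eventually_mono)
    qed
    have "filterlim Y at_top sequentially" unfolding Y_def by real_asymp
    then show "(\<lambda>n. integral {1..Y n} (expint_kernel z (1 - a))) \<longlonglongrightarrow> exp_integral (1 - a) z"
      using exp_integral_limit[of z "1 - a"] z a by (intro filterlim_compose[OF exp_integral_limit]) auto
  qed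
  moreover have "integral {X n..1} (expint_kernel z (1 - a)) + integral {1..Y n} (expint_kernel z (1 - a))
     = z powr (- a) * (g (z * of_real (Y n)) - g (z * of_real (X n)))" for n
    using XY[of n] by (simp add: integral_unique[OF kint] algebra_simps)
  ultimately have "(\<lambda>n. z powr (- a) * (g (z * of_real (Y n)) - g (z * of_real (X n))))
     \<longlonglongrightarrow> integral {0<..1} (expint_kernel z (1 - a)) + exp_integral (1 - a) z"
    by simp
  moreover have "(\<lambda>n. z powr (- a) * (g (z * of_real (Y n)) - g (z * of_real (X n))))
     \<longlonglongrightarrow> z powr (- a) * Gamma a"
    by (intro tendsto_intros rotated_lim)
  ultimately have "integral {0<..1} (expint_kernel z (1 - a)) + exp_integral (1 - a) z = z powr (- a) * Gamma a"
    by (rule LIMSEQ_unique)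
  then show ?thesis by (simp add: algebra_simps)
qed

section \<open>The expansion of the zeta function\<close>

text \<open>
  The point \<open>\<i> \<kappa>\<close> with \<open>\<kappa> = \<pi> (k + 1/2)\<close>, at which \<open>cos \<kappa> = 0\<close>.
\<close>
definition node :: "nat \<Rightarrow> complex" where
  "node k = \<i> * of_real pi * (of_nat k + 1 / 2)"

lemma node_altdef: "node k = \<i> * of_real (pi * (real k + 1 / 2))"
  by (simp add: node_def)

lemma norm_node: "norm (node k) \<ge> 1" and Re_node: "Re (node k) = 0" and node_nz: "node k \<noteq> 0"
proof -
  have "1 * 1 \<le> pi * (real k + 1 / 2)"
    using pi_gt3 mult_mono[of "2" pi "1 / 2" "real k + 1 / 2"] by simp
  then show "norm (node k) \<ge> 1" by (simp only: node_altdef norm_mult norm_of_real) simp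
  then show "node k \<noteq> 0" by auto
  show "Re (node k) = 0" by (simp only: node_altdef) simp
qed

lemma exp_node: "exp (node k) = \<i> * (- 1) ^ k" "exp (- node k) = - (\<i> * (- 1) ^ k)"
proof -
  have c: "cos (complex_of_real (pi * (real k + 1 / 2))) = 0"
    and s: "sin (complex_of_real (pi * (real k + 1 / 2))) = (- 1) ^ k"
    using cos_half_integer_pi[of k] sin_half_integer_pi[of k] by (simp_all only: cos_of_real sin_of_real) simp_all
  show "exp (node k) = \<i> * (- 1) ^ k"
    unfolding node_altdef exp_Euler c s by simp
  then show "exp (- node k) = - (\<i> * (- 1) ^ k)"
    unfolding exp_minus by (simp only:) (rule inverse_unique, simp add: mult_ac)
qed

lemma of_nat_half_nz: "complex_of_nat k + 1 / 2 \<noteq> 0"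
proof -
  have "Re (complex_of_nat k + 1 / 2) > 0" by simp
  then show ?thesis by (metis less_irrefl zero_complex.sel(1))
qed

definition series_term :: "nat \<Rightarrow> complex \<Rightarrow> nat \<Rightarrow> complex" where
  "series_term n s k = (exp_integral (1 + of_nat n - s) (- node k)
      + (- 1) ^ n * exp_integral (1 + of_nat n - s) (node k)) / (of_nat k + 1 / 2) ^ n"

text \<open>
  The last summand collects the boundary terms \<open>exp (\<plusminus> \<i> \<kappa>) = \<plusminus> \<i> (-1)^k\<close> of the two
  exponential integrals; the sign \<open>(-1)^n\<close> makes them cancel for odd \<open>n\<close>.
\<close>
lemma series_term_recurrence:
  "(1 + of_nat n - s) * series_term (Suc n) s k
     = \<i> * of_real pi * series_term n s k + \<i> * (1 + (- 1) ^ n) * ((- 1) ^ k / (of_nat k + 1 / 2) ^ Suc n)"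
proof -
  define p where "p = 1 + of_nat n - s"
  define x where "x = complex_of_nat k + 1 / 2"
  define E F where "E = exp_integral p (- node k)" and "F = exp_integral p (node k)"
  have x: "x \<noteq> 0" using of_nat_half_nz by (simp add: x_def)
  have m: "p * exp_integral (p + 1) (- node k) = \<i> * (- 1) ^ k + node k * E"
    using exp_integral_recurrence[of "- node k" p] by (simp add: Re_node node_nz exp_node E_def)
  have q: "p * exp_integral (p + 1) (node k) = - (\<i> * (- 1) ^ k) - node k * F"
    using exp_integral_recurrence[of "node k" p] by (simp add: Re_node node_nz exp_node F_def)
  have p1: "1 + of_nat (Suc n) - s = p + 1" by (simp add: p_def)
  have "p * series_term (Suc n) s k = (p * exp_integral (p + 1) (- node k)
      - (- 1) ^ n * (p * exp_integral (p + 1) (node k))) / x ^ Suc n"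
    unfolding series_term_def p1 x_def by (simp add: algebra_simps)
  also have "\<dots> = (node k * (E + (- 1) ^ n * F) + \<i> * (1 + (- 1) ^ n) * (- 1) ^ k) / x ^ Suc n"
    unfolding m q by (simp add: algebra_simps)
  also have "\<dots> = \<i> * of_real pi * ((E + (- 1) ^ n * F) / x ^ n) + \<i> * (1 + (- 1) ^ n) * ((- 1) ^ k / x ^ Suc n)"
    using x by (simp add: node_def flip: x_def) (simp add: field_simps)
  finally show ?thesis by (simp add: series_term_def p_def x_def E_def F_def)
qed

lemma summable_half_integer_power:
  "summable (\<lambda>k. norm (1 / (complex_of_nat k + 1 / 2) ^ (n + 2)))"
proof (induction n)
  case 0
  have eq: "norm (1 / (complex_of_nat k + 1 / 2) ^ 2) = 1 / (real k + 1 / 2)\<^sup>2" for k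
  proof -
    have "complex_of_nat k + 1 / 2 = of_real (real k + 1 / 2)" by simp
    then show ?thesis by (simp only: norm_divide norm_power norm_of_real norm_one power2_abs)
  qed
  show ?case unfolding add.left_neutral eq by (rule inverse_square_half_integers_summable)
next
  case (Suc n)
  show ?case
  proof (rule summable_comparison_test')
    show "summable (\<lambda>k. 2 * norm (1 / (complex_of_nat k + 1 / 2) ^ (n + 2)))"
      using Suc.IH by (rule summable_mult)
    fix k
    have "norm (complex_of_nat k + 1 / 2) \<ge> 1 / 2"
      using abs_Re_le_cmod[of "complex_of_nat k + 1 / 2"] by simp
    then have "norm (1 / (complex_of_nat k + 1 / 2)) \<le> 2"
      by (simp add: norm_divide divide_simps)
    then have "norm (1 / (complex_of_nat k + 1 / 2)) * norm (1 / (complex_of_nat k + 1 / 2) ^ (n + 2))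
       \<le> 2 * norm (1 / (complex_of_nat k + 1 / 2) ^ (n + 2))"
      by (rule mult_right_mono) simp
    then show "norm (norm (1 / (complex_of_nat k + 1 / 2) ^ (Suc n + 2))) \<le> 2 * norm (1 / (complex_of_nat k + 1 / 2) ^ (n + 2))"
      by (simp add: norm_divide norm_mult)
  qed
qed

lemma alternating_odd_power_sum_complex:
  "(\<lambda>k. (- 1) ^ k / (complex_of_nat k + 1 / 2) ^ Suc (2 * j)) sums
     of_real ((- 1) ^ j * pi ^ (2 * j + 1) * euler_number (2 * j) / (2 * fact (2 * j)))"
  using sums_of_real[OF alternating_odd_power_sum[of j], where 'a = complex] by simp

lemma boundary_summable:
  "summable (\<lambda>k. (1 + (- 1) ^ n) * ((- 1) ^ k / (complex_of_nat k + 1 / 2) ^ Suc n))"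
proof (cases "even n")
  case True
  then obtain j where "n = 2 * j" by auto
  then show ?thesis using sums_summable[OF alternating_odd_power_sum_complex[of j]] by (intro summable_mult) simp
qed simp

lemma series_term_sums_weights:
  "series_term n s k = 1 / (of_nat k + 1 / 2) ^ n * exp_integral (1 + of_nat n - s) (- node k)
     + (- 1) ^ n * (1 / (of_nat k + 1 / 2) ^ n * exp_integral (1 + of_nat n - s) (node k))"
  by (simp add: series_term_def add_divide_distrib)

text \<open>
  For \<open>n \<ge> 2\<close> the series converges absolutely because the exponential integrals are bounded.
  The cases \<open>n = 1\<close> and \<open>n = 0\<close> are reached downwards by the recurrence, whose boundary
  series converges by the alternating series test.
\<close>
lemma summable_series_term: "summable (series_term n s)"
proof -
  have ge2: "summable (series_term (m + 2) s)" for m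
    unfolding series_term_sums_weights[abs_def]
    by (intro summable_add summable_mult exp_integral_series summable_half_integer_power)
       (auto simp: norm_node Re_node)
  have down: "summable (series_term m s)" if "summable (series_term (Suc m) s)" for m
  proof -
    have "summable (\<lambda>k. (1 + of_nat m - s) / (\<i> * of_real pi) * series_term (Suc m) s k
        - 1 / of_real pi * ((1 + (- 1) ^ m) * ((- 1) ^ k / (of_nat k + 1 / 2) ^ Suc m)))"
      by (intro summable_diff summable_mult that boundary_summable)
    moreover have "(1 + of_nat m - s) / (\<i> * of_real pi) * series_term (Suc m) s k
        - 1 / of_real pi * ((1 + (- 1) ^ m) * ((- 1) ^ k / (of_nat k + 1 / 2) ^ Suc m)) = series_term m s k" for k
    proof -
      have "(1 + of_nat m - s) / (\<i> * of_real pi) * series_term (Suc m) s k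
         = (1 + of_nat m - s) * series_term (Suc m) s k / (\<i> * of_real pi)" by simp
      then show ?thesis unfolding series_term_recurrence by (simp add: add_divide_distrib)
    qed
    ultimately show ?thesis by simp
  qed
  have 1: "summable (series_term 1 s)" using ge2[of 0] down[of 1] by (simp add: numeral_2_eq_2)
  then have 0: "summable (series_term 0 s)" using down[of 0] by simp
  show ?thesis
  proof (cases "n \<ge> 2")
    case True
    then show ?thesis using ge2[of "n - 2"] by (simp only: le_add_diff_inverse2)
  next
    case False
    then have "n = 0 \<or> n = 1" by auto
    then show ?thesis using 0 1 by auto
  qed
qed

text \<open>
  The principal powers of \<open>\<plusminus> \<i>\<close> contribute the phases \<open>exp (\<plusminus> \<i> \<pi> a / 2)\<close>, whose sum is the cosine in the
  denominator of the expansion.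
\<close>
lemma rotated_powers_sum:
  fixes a :: complex and \<kappa> :: real
  assumes "\<kappa> > 0"
  shows "(- (\<i> * of_real \<kappa>)) powr (- a) + (\<i> * of_real \<kappa>) powr (- a)
     = of_real \<kappa> powr (- a) * (2 * cos (of_real pi * a / 2))"
proof -
  have L1: "Ln (of_real \<kappa> * \<i>) = of_real (ln \<kappa>) + \<i> * of_real pi / 2"
    using assms by (subst Ln_times_of_real) (auto simp: Ln_of_real)
  have L2: "Ln (of_real \<kappa> * - \<i>) = of_real (ln \<kappa>) - \<i> * of_real pi / 2"
    using assms by (subst Ln_times_of_real) (auto simp: Ln_of_real)
  have powr: "w powr (- a) = exp (- a * Ln w)" if "w \<noteq> 0" for w :: complex
    using that by (simp add: powr_def)
  have 1: "(of_real \<kappa> * \<i>) powr (- a) = of_real \<kappa> powr (- a) * exp (- (\<i> * (of_real pi * a / 2)))"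
  proof -
    have "(of_real \<kappa> * \<i>) powr (- a) = exp (- a * Ln (of_real \<kappa> * \<i>))"
      using assms by (intro powr) simp
    also have "\<dots> = of_real \<kappa> powr (- a) * exp (- (\<i> * (of_real pi * a / 2)))"
      unfolding L1 powr_of_real_eq_exp[OF assms] mult_exp_exp by (simp add: algebra_simps)
    finally show ?thesis .
  qed
  have 2: "(of_real \<kappa> * - \<i>) powr (- a) = of_real \<kappa> powr (- a) * exp (\<i> * (of_real pi * a / 2))"
  proof -
    have "(of_real \<kappa> * - \<i>) powr (- a) = exp (- a * Ln (of_real \<kappa> * - \<i>))"
      using assms by (intro powr) simp
    also have "\<dots> = of_real \<kappa> powr (- a) * exp (\<i> * (of_real pi * a / 2))"
      unfolding L2 powr_of_real_eq_exp[OF assms] mult_exp_exp by (simp add: algebra_simps)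
    finally show ?thesis .
  qed
  have e: "- (\<i> * of_real \<kappa>) = of_real \<kappa> * - \<i>" "\<i> * of_real \<kappa> = of_real \<kappa> * \<i>"
    by simp_all
  show ?thesis
    unfolding e(1) unfolding e(2) 1 2 cos_exp_eq by (simp add: algebra_simps)
qed

lemma beta_integral_triangle:
  fixes a :: complex
  assumes a: "0 < Re a"
  shows "((\<lambda>v. of_real v powr (a - 1) * (1 - of_real v)) has_integral 1 / (a * (a + 1))) {0<..1}"
proof -
  have nz: "a \<noteq> 0" "a + 1 \<noteq> 0" using a by (auto simp: complex_eq_iff)
  define A where "A = (\<lambda>w::complex. w powr a / a - w powr (a + 1) / (a + 1))"
  have "((\<lambda>v. of_real v powr (a - 1) * (1 - of_real v)) has_integral (A (of_real 1) - A (of_real 0))) {0..1}"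
  proof (rule fundamental_theorem_of_calculus_interior)
    show "continuous_on {0..1} (\<lambda>v. A (of_real v))"
      unfolding A_def using a nz
      by (intro continuous_intros continuous_on_powr_complex) (auto simp: )
    fix v :: real assume v: "v \<in> {0<..<1}"
    have v0: "complex_of_real v \<notin> \<real>\<^sub>\<le>\<^sub>0" using v by (simp add: complex_nonpos_Reals_iff)
    have d: "((\<lambda>w. w powr b) has_field_derivative b * of_real v powr (b - 1)) (at (complex_of_real v))" for b
      using v0 by (rule has_field_derivative_powr)
    have "(A has_field_derivative a * of_real v powr (a - 1) / a - (a + 1) * of_real v powr (a + 1 - 1) / (a + 1)) (at (complex_of_real v))"
      unfolding A_def by (intro DERIV_diff DERIV_cdivide d)
    also have "a * of_real v powr (a - 1) / a - (a + 1) * of_real v powr (a + 1 - 1) / (a + 1)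
       = of_real v powr (a - 1) * (1 - of_real v)"
    proof -
      have "of_real v powr a = of_real v powr (a - 1) * complex_of_real v"
        using v by (simp add: powr_diff)
      then show ?thesis using nz by (simp add: right_diff_distrib)
    qed
    finally show "((\<lambda>v. A (of_real v)) has_vector_derivative of_real v powr (a - 1) * (1 - of_real v)) (at v)"
      by (rule has_vector_derivative_real_field)
  qed simp
  also have "A (of_real 1) - A (of_real 0) = 1 / (a * (a + 1))"
    using nz by (simp add: A_def field_simps)
  finally show ?thesis
    by (rule has_integral_spike_set_eq[THEN iffD1, rotated 2]) (auto intro: negligible_subset[of "{0}"])
qed

text \<open>
  In this strip \<open>a = s - 2\<close> satisfies \<open>0 < Re a < 1\<close>, so the rotated Gamma integral applies,
  and at the same time the Dirichlet series converges and the Fourier series can be integrated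
  termwise.
\<close>
lemma zeta_expansion_two_strip:
  assumes s: "2 < Re s" "Re s < 3"
  shows "2 * cos (of_real pi * s / 2) * ((2 powr s - 1) * riemann_zeta s)
     = - (of_real pi powr s * rGamma s) - of_real pi powr (s - 2) * rGamma (s - 2) * (\<Sum>k. series_term 2 s k)"
proof -
  define a where "a = s - 2"
  have a: "0 < Re a" "Re a < 1" using s by (auto simp: a_def)
  define c where "c = cos (of_real pi * s / 2)"
  define Z where "Z = (2 powr s - 1) * riemann_zeta s"
  define \<kappa> where "\<kappa> = (\<lambda>k. pi * (real k + 1 / 2))"
  have \<kappa>: "\<kappa> k > 0" for k unfolding \<kappa>_def by (intro mult_pos_pos) auto
  have node: "node k = \<i> * of_real (\<kappa> k)" for k unfolding node_altdef \<kappa>_def ..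
  define w where "w = (\<lambda>k. 1 / (complex_of_nat k + 1 / 2)\<^sup>2)"
  have w_real: "w k = of_real (1 / (real k + 1 / 2)\<^sup>2)" for k by (simp add: w_def)
  define D where "D = (\<lambda>k. w k * (integral {0<..1} (expint_kernel (- node k) (1 - a)) + integral {0<..1} (expint_kernel (node k) (1 - a))))"
  have term_eq: "series_term 2 s k = (- 2 * c * Gamma a * of_real pi powr (- a)) * (of_nat k + 1 / 2) powr (- s) - D k" for k
  proof -
    have ca: "cos (of_real pi * a / 2) = - c"
    proof -
      have eq: "of_real pi * a / 2 = of_real pi * s / 2 - of_real pi" by (simp add: a_def field_simps)
      show ?thesis unfolding eq c_def cos_diff by simp
    qed
    have pw: "w k * of_real (\<kappa> k) powr (- a) = of_real pi powr (- a) * (of_nat k + 1 / 2) powr (- s)"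
    proof -
      have x: "complex_of_nat k + 1 / 2 = of_real (real k + 1 / 2)" by simp
      have "of_real (\<kappa> k) powr (- a) = of_real pi powr (- a) * of_real (real k + 1 / 2) powr (- a)"
        unfolding \<kappa>_def of_real_mult by (rule powr_times_real) auto
      moreover have "of_real (real k + 1 / 2) powr (- a) = of_real (real k + 1 / 2) powr (- s) * complex_of_real (real k + 1 / 2) ^ 2"
      proof -
        have "- a = - s + of_nat 2" by (simp add: a_def)
        then show ?thesis using of_nat_half_nz[of k] unfolding x by (simp only: powr_add powr_nat) simp
      qed
      moreover have "w k * complex_of_real (real k + 1 / 2) ^ 2 = 1"
        using of_nat_half_nz[of k] by (simp add: w_def)
      ultimately show ?thesis unfolding x by (simp add: mult_ac)
    qed
    have m: "exp_integral (1 - a) (- node k) = (- node k) powr (- a) * Gamma a - integral {0<..1} (expint_kernel (- node k) (1 - a))"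
      using gamma_integral_rotated[OF a, of "- \<i>" "\<kappa> k"] \<kappa>[of k] by (simp add: node)
    have p: "exp_integral (1 - a) (node k) = node k powr (- a) * Gamma a - integral {0<..1} (expint_kernel (node k) (1 - a))"
      using gamma_integral_rotated[OF a, of "\<i>" "\<kappa> k"] \<kappa>[of k] by (simp add: node)
    have "series_term 2 s k = w k * (exp_integral (1 - a) (- node k) + exp_integral (1 - a) (node k))"
      by (simp add: series_term_def w_def a_def)
    also have "\<dots> = w k * ((- node k) powr (- a) + node k powr (- a)) * Gamma a - D k"
      unfolding m p D_def by (simp add: algebra_simps)
    also have "(- node k) powr (- a) + node k powr (- a) = of_real (\<kappa> k) powr (- a) * (2 * - c)"
      unfolding node using rotated_powers_sum[OF \<kappa>, of k a] ca by simp
    also have "w k * (of_real (\<kappa> k) powr (- a) * (2 * - c)) * Gamma a = (w k * of_real (\<kappa> k) powr (- a)) * (- 2 * c * Gamma a)"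
      by simp
    finally show ?thesis unfolding pw by (simp add: mult_ac)
  qed
  have Z: "(\<lambda>k. (of_nat k + 1 / 2) powr (- s)) sums Z"
    unfolding Z_def using s by (intro half_integer_dirichlet_sums) auto
  have D: "D sums (of_real (pi\<^sup>2) * (1 / (a * (a + 1))))"
  proof -
    have int: "((\<lambda>v. w k * (of_real v powr (a - 1) * of_real (2 * cos (\<kappa> k * v)))) has_integral D k) {0<..1}" for k
    proof -
      have i: "(expint_kernel y (1 - a) has_integral integral {0<..1} (expint_kernel y (1 - a))) {0<..1}" if "Re y = 0" for y
        using expint_kernel_absolutely_integrable_unit[OF a(1), of y] that
        by (intro integrable_integral) (auto simp: absolutely_integrable_on_def)
      have "((\<lambda>v. w k * (expint_kernel (- node k) (1 - a) v + expint_kernel (node k) (1 - a) v)) has_integral D k) {0<..1}"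
        unfolding D_def by (intro has_integral_mult_right has_integral_add i) (auto simp: Re_node)
      then show ?thesis unfolding node sum_of_conjugate_kernels by simp
    qed
    have h: "(\<lambda>v. 2 * v powr (Re a - 1)) integrable_on {0<..1}"
      using a by (intro integrable_on_mult_right integrable_on_powr_from_0') auto
    have le: "norm (w k * (of_real v powr (a - 1) * of_real (2 * cos (\<kappa> k * v)))) \<le> norm (w k) * (2 * v powr (Re a - 1))"
      if "v \<in> {0<..1}" for k v
      unfolding norm_mult[of "w k"]
      using norm_sum_of_conjugate_kernels[of v "1 - a"] that by (intro mult_left_mono) auto
    have sums: "(\<lambda>k. w k * (of_real v powr (a - 1) * of_real (2 * cos (\<kappa> k * v)))) sums
        (of_real (pi\<^sup>2) * (of_real v powr (a - 1) * (1 - of_real v)))" if "v \<in> {0<..1}" for v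
    proof -
      have "(\<lambda>k. complex_of_real (cos (\<kappa> k * v) / (real k + 1 / 2)\<^sup>2)) sums of_real (pi\<^sup>2 / 2 * (1 - v))"
        unfolding \<kappa>_def using that by (intro sums_of_real fourier_triangle_wave) auto
      from sums_mult[OF this, of "2 * of_real v powr (a - 1)"]
      show ?thesis by (simp add: w_real mult_ac)
    qed
    have w: "summable (\<lambda>k. norm (w k))"
      using summable_half_integer_power[of 0] unfolding w_def add.left_neutral .
    have "D sums integral {0<..1} (\<lambda>v. of_real (pi\<^sup>2) * (of_real v powr (a - 1) * (1 - of_real v)))"
      by (rule sums_has_integral_dominated[OF int h _ _ _ le sums])
         (use w in auto)
    also have "integral {0<..1} (\<lambda>v. of_real (pi\<^sup>2) * (of_real v powr (a - 1) * (1 - of_real v))) = of_real (pi\<^sup>2) * (1 / (a * (a + 1)))"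
      using a by (intro integral_unique has_integral_mult_right beta_integral_triangle)
    finally show ?thesis .
  qed
  have "series_term 2 s sums ((- 2 * c * Gamma a * of_real pi powr (- a)) * Z - of_real (pi\<^sup>2) * (1 / (a * (a + 1))))"
    unfolding term_eq[abs_def] by (intro sums_diff sums_mult Z D)
  then have T: "(\<Sum>k. series_term 2 s k) = (- 2 * c * Gamma a * of_real pi powr (- a)) * Z - of_real (pi\<^sup>2) * (1 / (a * (a + 1)))"
    by (rule sums_unique[symmetric])
  have nz: "a \<noteq> 0" "a + 1 \<noteq> 0" using a by (auto simp: complex_eq_iff)
  have G: "rGamma a * Gamma a = 1"
  proof -
    have "a \<notin> \<int>\<^sub>\<le>\<^sub>0" using a by (auto elim!: nonpos_Ints_cases)
    then show ?thesis by (simp add: rGamma_inverse_Gamma Gamma_eq_zero_iff)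
  qed
  have rG: "rGamma a = a * (a + 1) * rGamma s"
  proof -
    have "a + 1 + 1 = s" by (simp add: a_def)
    then show ?thesis
      using rGamma_plus1[of a] rGamma_plus1[of "a + 1"] by (simp only: mult.assoc)
  qed
  have q: "rGamma a / (a * (a + 1)) = rGamma s" unfolding rG using nz by simp
  have pi_s: "of_real pi powr s = of_real pi powr a * complex_of_real (pi\<^sup>2)"
  proof -
    have "s = a + of_nat 2" by (simp add: a_def)
    then show ?thesis by (simp only: powr_add powr_nat) simp
  qed
  have pi_a: "of_real pi powr a * of_real pi powr (- a) = (1::complex)" by (simp add: powr_minus)
  have "of_real pi powr a * rGamma a * (\<Sum>k. series_term 2 s k)
     = - 2 * c * (rGamma a * Gamma a) * (of_real pi powr a * of_real pi powr (- a)) * Z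
       - (of_real pi powr a * of_real (pi\<^sup>2)) * (rGamma a / (a * (a + 1)))"
    unfolding T by (simp add: algebra_simps)
  also have "\<dots> = - 2 * c * Z - of_real pi powr s * rGamma s"
    unfolding G pi_a pi_s[symmetric] q by simp
  finally show ?thesis by (simp add: a_def c_def Z_def)
qed

text \<open>
  Clearing the denominator \<open>2 cos (\<pi> s / 2)\<close> and writing the finite sum with \<open>rGamma\<close> leaves
  \<open>s = 1\<close> as the only singularity, so a single application of the identity theorem suffices.
\<close>
lemma zeta_expansion_two:
  assumes s: "s \<noteq> 1"
  shows "2 * cos (of_real pi * s / 2) * ((2 powr s - 1) * riemann_zeta s)
     = - (of_real pi powr s * rGamma s) - of_real pi powr (s - 2) * rGamma (s - 2) * (\<Sum>k. series_term 2 s k)"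
proof -
  define T where "T = (\<lambda>s. (\<Sum>k. 1 / (of_nat k + 1 / 2)\<^sup>2 * exp_integral s (- node k)) + (\<Sum>k. 1 / (of_nat k + 1 / 2)\<^sup>2 * exp_integral s (node k)))"
  have w: "summable (\<lambda>k. norm (1 / (complex_of_nat k + 1 / 2)\<^sup>2))"
    using summable_half_integer_power[of 0] by (simp only: add.left_neutral)
  have T: "T holomorphic_on UNIV"
    unfolding T_def by (intro holomorphic_on_add exp_integral_series w) (auto simp: norm_node Re_node)
  have T_eq: "(\<Sum>k. series_term 2 s k) = T (3 - s)" for s
  proof -
    have "(\<Sum>k. series_term 2 s k) = (\<Sum>k. 1 / (of_nat k + 1 / 2)\<^sup>2 * exp_integral (3 - s) (- node k) + 1 / (of_nat k + 1 / 2)\<^sup>2 * exp_integral (3 - s) (node k))"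
      unfolding series_term_sums_weights[abs_def] by simp
    also have "\<dots> = T (3 - s)"
      unfolding T_def
      by (rule suminf_add[symmetric]) (intro exp_integral_series w; auto simp: norm_node Re_node)+
    finally show ?thesis .
  qed
  have T': "(\<lambda>s. T (3 - s)) holomorphic_on - {1}"
  proof -
    have "(\<lambda>s::complex. 3 - s) holomorphic_on - {1}" by (intro holomorphic_intros)
    from holomorphic_on_compose_gen[OF this T] show ?thesis by (simp add: o_def)
  qed
  show ?thesis
    unfolding T_eq
  proof (rule analytic_continuation_open[where s = "{s. 2 < Re s} \<inter> {s. Re s < 3}" and s' = "- {1}"
      and f = "\<lambda>s. 2 * cos (of_real pi * s / 2) * ((2 powr s - 1) * riemann_zeta s)"
      and g = "\<lambda>s. - (of_real pi powr s * rGamma s) - of_real pi powr (s - 2) * rGamma (s - 2) * T (3 - s)"])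
    show "open ({s. 2 < Re s} \<inter> {s. Re s < 3})"
      by (intro open_Int open_halfspace_Re_gt open_halfspace_Re_lt)
    have "(5 / 2 :: complex) \<in> {s. 2 < Re s} \<inter> {s. Re s < 3}" by simp
    then show "{s. 2 < Re s} \<inter> {s. Re s < 3} \<noteq> {}" by blast
    show "connected (- {1::complex})" by (intro connected_punctured_universe) auto
    show "(\<lambda>s. 2 * cos (of_real pi * s / 2) * ((2 powr s - 1) * riemann_zeta s)) holomorphic_on - {1}"
      by (intro holomorphic_intros riemann_zeta_holomorphic) auto
    show "(\<lambda>s. - (of_real pi powr s * rGamma s) - of_real pi powr (s - 2) * rGamma (s - 2) * T (3 - s)) holomorphic_on - {1}"
      by (intro holomorphic_intros T')
    show "2 * cos (of_real pi * s / 2) * ((2 powr s - 1) * riemann_zeta s)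
       = - (of_real pi powr s * rGamma s) - of_real pi powr (s - 2) * rGamma (s - 2) * T (3 - s)"
      if "s \<in> {s. 2 < Re s} \<inter> {s. Re s < 3}" for s
      using zeta_expansion_two_strip[of s] that unfolding T_eq by simp
  qed (use s in auto)
qed

lemma sin_cos_half_pi_nonzero:
  fixes s :: complex
  assumes "s \<notin> \<int>"
  shows "sin (of_real pi * s / 2) \<noteq> 0" "cos (of_real pi * s / 2) \<noteq> 0"
proof -
  have "sin (of_real pi * s) \<noteq> 0"
  proof
    assume "sin (of_real pi * s) = 0"
    then obtain n where "of_real pi * s = of_real (of_int n * pi)"
      by (auto simp: sin_eq_0)
    then have "s = of_int n" by simp
    with assms show False by simp
  qed
  moreover have "sin (of_real pi * s) = 2 * sin (of_real pi * s / 2) * cos (of_real pi * s / 2)"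
    using sin_double[of "of_real pi * s / 2"] by simp
  ultimately show "sin (of_real pi * s / 2) \<noteq> 0" "cos (of_real pi * s / 2) \<noteq> 0" by auto
qed

text \<open>
  Converts a summand of the finite sum into the shape of the coefficient of the infinite
  series.
\<close>
lemma Gamma_reflection_even_shift:
  fixes s :: complex
  assumes s: "s \<notin> \<int>"
  shows "of_real pi powr (s - 1) * sin (of_real pi * s / 2) * Gamma (of_nat (2 * m + 1) - s)
     = of_real pi powr s * rGamma (s - of_nat (2 * m)) / (2 * cos (of_real pi * s / 2))"
proof -
  define z where "z = s - of_nat (2 * m)"
  note nz = sin_cos_half_pi_nonzero[OF s]
  have zZ: "z \<notin> \<int>"
  proof
    assume "z \<in> \<int>"
    then have "z + of_nat (2 * m) \<in> \<int>" by (intro Ints_add) auto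
    then show False using s by (simp add: z_def)
  qed
  then have "z \<notin> \<int>\<^sub>\<le>\<^sub>0" using nonpos_Ints_Int by blast
  then have G: "Gamma z \<noteq> 0" by (simp add: Gamma_eq_zero_iff)
  have "sin (of_real pi * z) = sin (of_real pi * s)"
  proof -
    have "of_real pi * z = of_real pi * s - of_nat m * (2 * of_real pi)"
      by (simp add: z_def algebra_simps)
    moreover have "of_nat m * (2 * complex_of_real pi) = of_real (2 * real m * pi)" by simp
    ultimately have "of_real pi * z = of_real pi * s - of_real (2 * real m * pi)" by (simp only:)
    then show ?thesis by (simp only: sin_diff sin_of_real cos_of_real sin_2npi cos_2npi) simp
  qed
  also have "\<dots> = 2 * sin (of_real pi * s / 2) * cos (of_real pi * s / 2)"
    using sin_double[of "of_real pi * s / 2"] by simp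
  finally have sinz: "sin (of_real pi * z) = 2 * sin (of_real pi * s / 2) * cos (of_real pi * s / 2)" .
  have "Gamma (1 - z) = rGamma z * (Gamma z * Gamma (1 - z))"
    using G by (simp add: rGamma_inverse_Gamma)
  also have "\<dots> = rGamma z * (of_real pi / sin (of_real pi * z))"
    by (simp only: Gamma_reflection_complex)
  finally have "Gamma (1 - z) = rGamma z * (of_real pi / (2 * sin (of_real pi * s / 2) * cos (of_real pi * s / 2)))"
    unfolding sinz .
  moreover have "of_nat (2 * m + 1) - s = 1 - z" by (simp add: z_def)
  ultimately have G1: "Gamma (of_nat (2 * m + 1) - s)
      = rGamma z * (of_real pi / (2 * sin (of_real pi * s / 2) * cos (of_real pi * s / 2)))" by (simp only:)
  show ?thesis
    unfolding G1 z_def[symmetric] using nz by (simp add: powr_diff)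
qed

text \<open>
  The right-hand side of the theorem; the condition \<open>2 * j < n\<close> says that \<open>j\<close> is at most the
  integer part of \<open>(n - 1) / 2\<close>.
\<close>
definition zeta_expansion :: "nat \<Rightarrow> complex \<Rightarrow> complex" where
  "zeta_expansion n s =
        - (of_real pi powr (s - 1) * sin (of_real pi * s / 2) *
            (\<Sum>j | 2 * j < n. Gamma (of_nat (2 * j + 1) - s) * of_real (euler_number (2 * j))
                 / Gamma (of_nat (2 * j + 1))))
        + of_real pi powr (s - of_nat n) * exp (\<i> * of_real pi * of_nat n / 2)
            * rGamma (s - of_nat n) / (2 * cos (of_real pi * s / 2))
            * (\<Sum>k. series_term n s k)"

text \<open>
  In the proof, \<open>U\<close> is the coefficient of the infinite series and \<open>B\<close> the sum of the boundary
  terms. Raising \<open>n\<close> by one changes the infinite part by \<open>U B / \<pi>\<close>. This is zero for odd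
  \<open>n\<close>, when the finite sum does not grow, and equals the new summand for even \<open>n\<close>.
\<close>
lemma zeta_expansion_Suc:
  assumes s: "s \<notin> \<int>"
  shows "zeta_expansion (Suc n) s = zeta_expansion n s"
proof -
  define p where "p = 1 + of_nat n - s"
  define c where "c = cos (of_real pi * s / 2)"
  define S where "S = (\<lambda>n. \<Sum>k. series_term n s k)"
  define e where "e = exp (\<i> * of_real pi * of_nat n / 2)"
  define U where "U = of_real pi powr (s - of_nat n) * e * rGamma (s - of_nat n) / (2 * c)"
  define B where "B = (\<Sum>k. (1 + (- 1) ^ n) * ((- 1) ^ k / (complex_of_nat k + 1 / 2) ^ Suc n))"
  have S: "series_term n s sums S n" for n
    unfolding S_def by (rule summable_sums[OF summable_series_term])
  have "(\<lambda>k. p * series_term (Suc n) s k) sums (p * S (Suc n))"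
    by (intro sums_mult S)
  moreover have "(\<lambda>k. \<i> * of_real pi * series_term n s k + \<i> * ((1 + (- 1) ^ n) * ((- 1) ^ k / (of_nat k + 1 / 2) ^ Suc n)))
     sums (\<i> * of_real pi * S n + \<i> * B)"
    unfolding B_def by (intro sums_add sums_mult S summable_sums boundary_summable)
  ultimately have pS: "p * S (Suc n) = \<i> * of_real pi * S n + \<i> * B"
    unfolding p_def series_term_recurrence by (simp only: mult.assoc sums_unique2)
  have rG: "rGamma (s - of_nat (Suc n)) = - p * rGamma (s - of_nat n)"
    using rGamma_plus1[of "s - of_nat (Suc n)"] by (simp add: p_def algebra_simps)
  have pw: "of_real pi powr (s - of_nat (Suc n)) = of_real pi powr (s - of_nat n) / (of_real pi :: complex)"
  proof -
    have "s - of_nat (Suc n) = (s - of_nat n) - 1" by simp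
    then show ?thesis by (simp only: powr_diff) simp
  qed
  have e: "exp (\<i> * of_real pi * of_nat (Suc n) / 2) = e * \<i>"
  proof -
    have "\<i> * of_real pi * of_nat (Suc n) / 2 = \<i> * of_real pi * of_nat n / 2 + \<i> * (of_real pi / 2)"
      by (simp add: field_simps)
    moreover have "exp (\<i> * (of_real pi / 2)) = \<i>"
      using cis_pi_half by (simp add: cis_conv_exp)
    ultimately show ?thesis by (simp only: exp_add e_def)
  qed
  have "of_real pi powr (s - of_nat (Suc n)) * exp (\<i> * of_real pi * of_nat (Suc n) / 2)
            * rGamma (s - of_nat (Suc n)) / (2 * c) * S (Suc n) = - U * \<i> / of_real pi * (p * S (Suc n))"
    unfolding rG pw e U_def by (simp add: mult_ac)
  also have "\<dots> = - (\<i> * \<i>) * (U / of_real pi * of_real pi * S n + U / of_real pi * B)"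
    unfolding pS by (simp add: ring_distribs mult_ac)
  also have "\<dots> = U * S n + U / of_real pi * B" by simp
  finally have W: "of_real pi powr (s - of_nat (Suc n)) * exp (\<i> * of_real pi * of_nat (Suc n) / 2)
            * rGamma (s - of_nat (Suc n)) / (2 * c) * S (Suc n) = U * S n + U / of_real pi * B" .
  define g where "g = (\<lambda>j. Gamma (of_nat (2 * j + 1) - s) * of_real (euler_number (2 * j))
                 / Gamma (of_nat (2 * j + 1)))"
  define P where "P = of_real pi powr (s - 1) * sin (of_real pi * s / 2)"
  have fin: "finite {j. 2 * j < n}" by (rule finite_subset[of _ "{..n}"]) auto
  have "P * sum g {j. 2 * j < Suc n} = P * sum g {j. 2 * j < n} + U / of_real pi * B"
  proof (cases "even n")
    case False
    then have "{j. 2 * j < Suc n} = {j. 2 * j < n}" by (auto simp: less_Suc_eq)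
    moreover have "B = 0" using False by (simp add: B_def)
    ultimately show ?thesis by simp
  next
    case True
    then obtain m where m: "n = 2 * m" by auto
    have "{j. 2 * j < Suc n} = insert m {j. 2 * j < n}" by (auto simp: m)
    then have "P * sum g {j. 2 * j < Suc n} = P * sum g {j. 2 * j < n} + P * g m"
      using fin by (simp add: m algebra_simps)
    moreover have "P * g m = U / of_real pi * B"
    proof -
      have "B = 2 * of_real ((- 1) ^ m * pi ^ (2 * m + 1) * euler_number (2 * m) / (2 * fact (2 * m)))"
        unfolding B_def using sums_mult[OF alternating_odd_power_sum_complex[of m], of 2]
        by (simp add: m sums_unique[symmetric])
      then have B: "B = (- 1) ^ m * (of_real pi ^ (2 * m) * of_real pi) * of_real (euler_number (2 * m)) / fact (2 * m)"
        by (simp add: mult_ac)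
      have pi_nz: "complex_of_real pi \<noteq> 0" by simp
      have em: "e = (- 1) ^ m"
      proof -
        have "e = exp (of_nat m * (\<i> * of_real pi))" by (simp add: e_def m mult_ac)
        also have "\<dots> = (- 1) ^ m" by (simp only: exp_of_nat_mult) simp
        finally show ?thesis .
      qed
      have pm: "of_real pi powr s = of_real pi powr (s - of_nat n) * complex_of_real pi ^ (2 * m)"
      proof -
        have "s = (s - of_nat n) + of_nat (2 * m)" by (simp add: m)
        then have "of_real pi powr s = of_real pi powr ((s - of_nat n) + of_nat (2 * m))" by simp
        also have "\<dots> = of_real pi powr (s - of_nat n) * complex_of_real pi ^ (2 * m)"
          by (simp only: powr_add powr_nat) simp
        finally show ?thesis .
      qed
      have "P * g m = P * Gamma (of_nat (2 * m + 1) - s) * of_real (euler_number (2 * m)) / fact (2 * m)"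
        using Gamma_fact[of "2 * m", where 'a = complex] by (simp add: g_def add.commute)
      also have "\<dots> = of_real pi powr (s - of_nat n) * of_real pi ^ (2 * m) * rGamma (s - of_nat n) / (2 * c) * of_real (euler_number (2 * m)) / fact (2 * m)"
        unfolding P_def Gamma_reflection_even_shift[OF s] pm c_def by (simp add: m)
      also have "\<dots> = U / of_real pi * B"
      proof -
        have aux: "(x * \<epsilon> * r / d) / p * (\<epsilon> * (q * p) * y / f) = (\<epsilon> * \<epsilon>) * (x * q * r / d * y / f)"
          if "p \<noteq> 0" for x \<epsilon> r d p q y f :: complex
          using that by (simp add: mult_ac)
        show ?thesis
          unfolding U_def em B aux[OF pi_nz] minus_one_mult_self by simp
      qed
      finally show ?thesis .
    qed
    ultimately show ?thesis by simp
  qed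
  moreover have "zeta_expansion n s = - (P * sum g {j. 2 * j < n}) + U * S n"
    unfolding zeta_expansion_def P_def g_def U_def e_def c_def S_def by (rule refl)
  moreover have "zeta_expansion (Suc n) s = - (P * sum g {j. 2 * j < Suc n}) + (U * S n + U / of_real pi * B)"
    unfolding W[symmetric] unfolding zeta_expansion_def P_def g_def c_def S_def by (rule refl)
  ultimately show ?thesis by simp
qed

lemma euler_number_0: "euler_number 0 = 1"
  by (simp add: euler_number_def)

lemma zeta_expansion_eq:
  assumes s: "s \<notin> \<int>"
  shows "zeta_expansion n s = (2 powr s - 1) * riemann_zeta s"
proof -
  have s1: "s \<noteq> 1" using s by auto
  define c where "c = cos (of_real pi * s / 2)"
  have c: "c \<noteq> 0" using sin_cos_half_pi_nonzero[OF s] by (simp add: c_def)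
  have "{j. 2 * j < (2::nat)} = {0}" by auto
  moreover have "exp (\<i> * of_real pi * of_nat 2 / 2) = - 1" by simp
  ultimately have "zeta_expansion 2 s = - (of_real pi powr (s - 1) * sin (of_real pi * s / 2) * Gamma (of_nat (2 * 0 + 1) - s))
      - of_real pi powr (s - 2) * rGamma (s - 2) / (2 * c) * (\<Sum>k. series_term 2 s k)"
    by (simp add: zeta_expansion_def euler_number_0 c_def)
  also have "\<dots> = (- (of_real pi powr s * rGamma s) - of_real pi powr (s - 2) * rGamma (s - 2) * (\<Sum>k. series_term 2 s k)) / (2 * c)"
    unfolding Gamma_reflection_even_shift[OF s] by (simp add: c_def diff_divide_distrib)
  also have "\<dots> = (2 powr s - 1) * riemann_zeta s"
    unfolding zeta_expansion_two[OF s1, symmetric] c_def[symmetric] using c by simp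
  finally have 2: "zeta_expansion 2 s = (2 powr s - 1) * riemann_zeta s" .
  have const: "zeta_expansion m s = zeta_expansion 0 s" for m
    by (induction m) (simp_all add: zeta_expansion_Suc[OF s])
  show ?thesis using 2 const[of 2] const[of n] by simp
qed

theorem mainTheorem2:
  fixes n :: nat and s :: complex
  assumes "\<not> (s \<in> \<int> \<and> s \<noteq> 0)"
  shows "let a = (\<lambda>k::nat.
        (exp_integral (1 + of_nat n - s) (- (\<i> * of_real pi * (of_nat k + 1 / 2)))
          + (- 1) ^ n * exp_integral (1 + of_nat n - s) (\<i> * of_real pi * (of_nat k + 1 / 2)))
        / (of_nat k + 1 / 2) ^ n)
    in summable a \<and>
      (2 powr s - 1) * riemann_zeta s =
        - (of_real pi powr (s - 1) * sin (of_real pi * s / 2) *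
            (\<Sum>j | int j \<le> \<lfloor>(real n - 1) / 2\<rfloor>.
               Gamma (of_nat (2 * j + 1) - s) * of_real (euler_number (2 * j))
                 / Gamma (of_nat (2 * j + 1))))
        + of_real pi powr (s - of_nat n) * exp (\<i> * of_real pi * of_nat n / 2)
            * rGamma (s - of_nat n) / (2 * cos (of_real pi * s / 2))
            * (\<Sum>k. a k)"
proof -
  have range: "{j. int j \<le> \<lfloor>(real n - 1) / 2\<rfloor>} = {j. 2 * j < n}"
  proof (intro Collect_cong)
    fix j
    have "int j \<le> \<lfloor>(real n - 1) / 2\<rfloor> \<longleftrightarrow> real j \<le> (real n - 1) / 2"
      by (simp add: le_floor_iff)
    also have "\<dots> \<longleftrightarrow> real (2 * j + 1) \<le> real n" by (simp add: field_simps)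
    also have "\<dots> \<longleftrightarrow> 2 * j < n" by (simp only: of_nat_le_iff) auto
    finally show "int j \<le> \<lfloor>(real n - 1) / 2\<rfloor> \<longleftrightarrow> 2 * j < n" .
  qed
  have "(2 powr s - 1) * riemann_zeta s = zeta_expansion n s"
  proof (cases "s = 0")
    case True
    have "rGamma (- of_nat n :: complex) = 0" by (simp add: rGamma_eq_zero_iff)
    then show ?thesis using True by (simp add: zeta_expansion_def)
  next
    case False
    then show ?thesis using assms zeta_expansion_eq by auto
  qed
  then show ?thesis
    using summable_series_term[of n s]
    unfolding Let_def range zeta_expansion_def series_term_def[abs_def] node_def by blast
qed

end
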